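(* There exists a smooth embedding $F_0:M\to\mathbb{R}^4$ of a two-torus $M$ with nowhere vanishing mean curvature vector, whose principal normal is parallel and whose normal bundle is flat, such that along the mean curvature flow $F:M\times[0,T)\to\mathbb{R}^4$ starting from $F_0$: (i) there is $\delta\in(0,T)$ such that for every $t\in(0,\delta)$ the principal normal of $F_t=F(\cdot,t)$ is not parallel; (ii) the normal bundle of $F_t$ is flat for all times $t$ for which the flow exists.
   Context: For an immersion $F:M^m\to\mathbb{R}^n$ with induced metric $g$, the normal connection is $\nabla^\perp_X\nu=(D_X\nu)^\perp$, where $D$ is the Euclidean connection. Its curvature is $R^\perp(X,Y)\nu=\nabla^\perp_X\nabla^\perp_Y\nu-\nabla^\perp_Y\nabla^\perp_X\nu-\nabla^\perp_{[X,Y]}\nu$. The normal bundle is flat if $R^\perp\equiv0$. The second fundamental form is $A(X,Y)=(D_XY)^\perp$ and the mean curvature vector is $H=\mathrm{tr}_gA$. If $H$ vanishes nowhere, the principal normal is the unit normal field $\mathbf{n}=H/|H|$. It is parallel if $\nabla^\perp\mathbf{n}=0$ on $M$. A mean curvature flow starting from $F_0$ is a smooth family of immersions $F:M\times[0,T)\to\mathbb{R}^n$ with $\frac{dF}{dt}(\cdot,t)=H(\cdot,t)$ and $F(\cdot,0)=F_0$. For compact $M$ without boundary there is a unique maximal smooth solution. *)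

theory Defs
  imports "HOL-Analysis.Analysis"
begin

text \<open>
  The torus of dimension \<open>CARD('m)\<close> is \<open>\<real>\<^sup>m / \<int>\<^sup>m\<close>. Maps and tensor fields on it are
  represented by their \<open>\<int>\<^sup>m\<close>-periodic lifts to \<^typ>\<open>real ^ 'm\<close>; since the tangent bundle is
  trivialised by the coordinate fields, a vector field is a periodic map
  \<^typ>\<open>real ^ 'm \<Rightarrow> real ^ 'm\<close>.
\<close>

definition int_lattice :: "(real ^ 'm) set" where
  "int_lattice = {k. \<forall>i. k $ i \<in> \<int>}"

definition torus_periodic :: "(real ^ 'm \<Rightarrow> 'a) \<Rightarrow> bool" where
  "torus_periodic f \<longleftrightarrow> (\<forall>p. \<forall>k\<in>int_lattice. f (p + k) = f p)"

text \<open>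
  The derivatives are taken within \<open>S\<close>, so that on \<open>UNIV \<times> {0..<T}\<close> smoothness includes the
  one-sided time derivatives at \<open>0\<close>. The definition is meant for sets on which the derivative
  is unique, such as open sets and convex sets with nonempty interior.
\<close>

primrec Ck_on :: "nat \<Rightarrow> ('a::euclidean_space \<Rightarrow> 'b::real_normed_vector) \<Rightarrow> 'a set \<Rightarrow> bool" where
  "Ck_on 0 f S \<longleftrightarrow> continuous_on S f"
| "Ck_on (Suc k) f S \<longleftrightarrow>
     f differentiable_on S \<and> (\<forall>v. Ck_on k (\<lambda>x. frechet_derivative f (at x within S) v) S)"

definition smooth_on :: "('a::euclidean_space \<Rightarrow> 'b::real_normed_vector) \<Rightarrow> 'a set \<Rightarrow> bool" where
  "smooth_on f S \<longleftrightarrow> (\<forall>k. Ck_on k f S)"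

definition dir_deriv :: "(real ^ 'm \<Rightarrow> 'a::real_normed_vector) \<Rightarrow> real ^ 'm \<Rightarrow> real ^ 'm \<Rightarrow> 'a" where
  "dir_deriv f p v = frechet_derivative f (at p) v"

definition torus_immersion :: "(real ^ 'm \<Rightarrow> 'a::euclidean_space) \<Rightarrow> bool" where
  "torus_immersion F \<longleftrightarrow> torus_periodic F \<and> smooth_on F UNIV \<and> (\<forall>p. inj (dir_deriv F p))"

text \<open>
  The last two conditions say that the map induced on the quotient \<open>\<real>\<^sup>m / \<int>\<^sup>m\<close> is injective and
  that it is a homeomorphism onto its image.
\<close>

definition torus_embedding :: "(real ^ 'm \<Rightarrow> 'a::euclidean_space) \<Rightarrow> bool" where
  "torus_embedding F \<longleftrightarrow> torus_immersion F \<and>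
     (\<forall>p q. F p = F q \<longrightarrow> p - q \<in> int_lattice) \<and>
     quotient_map euclidean (top_of_set (range F)) F"

definition tangent_space :: "(real ^ 'm \<Rightarrow> 'a::euclidean_space) \<Rightarrow> real ^ 'm \<Rightarrow> 'a set" where
  "tangent_space F p = range (dir_deriv F p)"

definition normal_space :: "(real ^ 'm \<Rightarrow> 'a::euclidean_space) \<Rightarrow> real ^ 'm \<Rightarrow> 'a set" where
  "normal_space F p = orthogonal_comp (tangent_space F p)"

definition normal_part :: "(real ^ 'm \<Rightarrow> 'a::euclidean_space) \<Rightarrow> real ^ 'm \<Rightarrow> 'a \<Rightarrow> 'a" where
  "normal_part F p w = (THE n. n \<in> normal_space F p \<and> w - n \<in> tangent_space F p)"

definition torus_vector_field :: "(real ^ 'm \<Rightarrow> real ^ 'm) \<Rightarrow> bool" where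
  "torus_vector_field X \<longleftrightarrow> torus_periodic X \<and> smooth_on X UNIV"

definition normal_field ::
    "(real ^ 'm \<Rightarrow> 'a::euclidean_space) \<Rightarrow> (real ^ 'm \<Rightarrow> 'a) \<Rightarrow> bool" where
  "normal_field F \<nu> \<longleftrightarrow> torus_periodic \<nu> \<and> smooth_on \<nu> UNIV \<and> (\<forall>p. \<nu> p \<in> normal_space F p)"

definition lie_bracket ::
    "(real ^ 'm \<Rightarrow> real ^ 'm) \<Rightarrow> (real ^ 'm \<Rightarrow> real ^ 'm) \<Rightarrow> real ^ 'm \<Rightarrow> real ^ 'm" where
  "lie_bracket X Y p = dir_deriv Y p (X p) - dir_deriv X p (Y p)"

definition normal_connection ::
    "(real ^ 'm \<Rightarrow> 'a::euclidean_space) \<Rightarrow> (real ^ 'm \<Rightarrow> real ^ 'm) \<Rightarrow>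
     (real ^ 'm \<Rightarrow> 'a) \<Rightarrow> real ^ 'm \<Rightarrow> 'a" where
  "normal_connection F X \<nu> p = normal_part F p (dir_deriv \<nu> p (X p))"

definition normal_curvature ::
    "(real ^ 'm \<Rightarrow> 'a::euclidean_space) \<Rightarrow> (real ^ 'm \<Rightarrow> real ^ 'm) \<Rightarrow>
     (real ^ 'm \<Rightarrow> real ^ 'm) \<Rightarrow> (real ^ 'm \<Rightarrow> 'a) \<Rightarrow> real ^ 'm \<Rightarrow> 'a" where
  "normal_curvature F X Y \<nu> p =
     normal_connection F X (normal_connection F Y \<nu>) p
     - normal_connection F Y (normal_connection F X \<nu>) p
     - normal_connection F (lie_bracket X Y) \<nu> p"

definition flat_normal_bundle :: "(real ^ 'm \<Rightarrow> 'a::euclidean_space) \<Rightarrow> bool" where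
  "flat_normal_bundle F \<longleftrightarrow>
     (\<forall>X Y \<nu>. torus_vector_field X \<longrightarrow> torus_vector_field Y \<longrightarrow> normal_field F \<nu> \<longrightarrow>
        (\<forall>p. normal_curvature F X Y \<nu> p = 0))"

text \<open>A field \<open>Y\<close> is differentiated in the ambient space through its pushforward \<open>dF(Y)\<close>.\<close>

definition second_fundamental_form ::
    "(real ^ 'm \<Rightarrow> 'a::euclidean_space) \<Rightarrow> (real ^ 'm \<Rightarrow> real ^ 'm) \<Rightarrow>
     (real ^ 'm \<Rightarrow> real ^ 'm) \<Rightarrow> real ^ 'm \<Rightarrow> 'a" where
  "second_fundamental_form F X Y p =
     normal_part F p (dir_deriv (\<lambda>q. dir_deriv F q (Y q)) p (X p))"

definition coord_field :: "'m \<Rightarrow> real ^ 'm \<Rightarrow> real ^ 'm" where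
  "coord_field i p = axis i 1"

definition induced_metric :: "(real ^ 'm \<Rightarrow> 'a::euclidean_space) \<Rightarrow> real ^ 'm \<Rightarrow> real ^ 'm ^ 'm" where
  "induced_metric F p =
     (\<chi> i j. dir_deriv F p (coord_field i p) \<bullet> dir_deriv F p (coord_field j p))"

definition mean_curvature :: "(real ^ 'm \<Rightarrow> 'a::euclidean_space) \<Rightarrow> real ^ 'm \<Rightarrow> 'a" where
  "mean_curvature F p =
     (\<Sum>i\<in>UNIV. \<Sum>j\<in>UNIV. matrix_inv (induced_metric F p) $ i $ j *\<^sub>R
        second_fundamental_form F (coord_field i) (coord_field j) p)"

definition nowhere_vanishing_mean_curvature :: "(real ^ 'm \<Rightarrow> 'a::euclidean_space) \<Rightarrow> bool" where
  "nowhere_vanishing_mean_curvature F \<longleftrightarrow> (\<forall>p. mean_curvature F p \<noteq> 0)"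

text \<open>The next two notions are only meaningful if the mean curvature vector vanishes nowhere.\<close>

definition principal_normal :: "(real ^ 'm \<Rightarrow> 'a::euclidean_space) \<Rightarrow> real ^ 'm \<Rightarrow> 'a" where
  "principal_normal F p = mean_curvature F p /\<^sub>R norm (mean_curvature F p)"

definition parallel_principal_normal :: "(real ^ 'm \<Rightarrow> 'a::euclidean_space) \<Rightarrow> bool" where
  "parallel_principal_normal F \<longleftrightarrow>
     (\<forall>X. torus_vector_field X \<longrightarrow> (\<forall>p. normal_connection F X (principal_normal F) p = 0))"

text \<open>
  \<open>F t\<close> is the immersion at time \<open>t\<close>; its values outside \<open>{0..<T}\<close> are irrelevant.
  The time \<open>T\<close> may be infinite.
\<close>

definition mean_curvature_flow ::
    "(real ^ 'm \<Rightarrow> 'a::euclidean_space) \<Rightarrow> ereal \<Rightarrow> (real \<Rightarrow> real ^ 'm \<Rightarrow> 'a) \<Rightarrow> bool" where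
  "mean_curvature_flow F0 T F \<longleftrightarrow> 0 < T \<and>
     (let I = {t. 0 \<le> t \<and> ereal t < T} in
        smooth_on (\<lambda>(p, t). F t p) (UNIV \<times> I) \<and>
        (\<forall>t\<in>I. torus_immersion (F t)) \<and>
        (\<forall>p. \<forall>t\<in>I. ((\<lambda>s. F s p) has_vector_derivative mean_curvature (F t) p) (at t within I)) \<and>
        F 0 = F0)"

end

theory Submission
  imports Defs
begin

text \<open>
  The initial surface is a torus of revolution in the unit 3-sphere that has constant nonzero mean
  curvature there but is not a Clifford torus. Inside the sphere a surface has flat normal bundle, with
  the position vector and the normal in the sphere as parallel frame, and its principal normal is parallel
  if and only if \<open>|H|\<close> is constant. By the maximum principle for \<open>|F|\<^sup>2 + 4t\<close> every mean curvature
  flow starting from it stays in the spheres of radius \<open>sqrt (1 - 4t)\<close>, so the normal bundle remains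
  flat. At time \<open>0\<close> the evolution equation of \<open>|H|\<^sup>2\<close> reads \<open>\<partial>\<^sub>t |H|\<^sup>2 = 2 |A\<^sup>H|\<^sup>2\<close>; the right-hand
  side is not constant on the surface, so \<open>|H|\<close> ceases to be constant at once.

  The square \<open>u\<close> of the distance from the axis of revolution satisfies \<open>u'\<^sup>2 = P u\<close> for a quadratic
  polynomial \<open>P\<close>, so that \<open>u = a + b * cos (4 * pi * x)\<close>, and the remaining angle \<open>\<phi>\<close> is an integral
  of an explicit function of \<open>u\<close>. The torus closes up after two periods of \<open>u\<close> for a suitable \<open>a\<close>.
\<close>

section \<open>Calculus of smooth maps\<close>

text \<open>On a Clifford torus the principal curvatures are constant, hence so is
  \<open>|A^H|\<close>; the example needs a varying profile, while constant mean curvature in the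
  sphere keeps \<open>|H|\<close> constant. The flow is an arbitrary solution, so its position on
  spheres has to come from the equation itself: \<open>(d/dt - Laplacian) |F|^2 = -4\<close> for a
  surface. At time 0 only one-sided time derivatives exist, yet the rate of \<open>|H|^2\<close>
  requires exchanging \<open>d/dt\<close> with two successive space derivatives; this dictates the
  integral form of the mixed derivative lemma. The constant curvature sum integrates once along the
  profile to a function \<open>w\<close> that is linear in \<open>u\<close>. Unit length of the
  normal then yields \<open>P\<close>, and comparing coefficients fixes \<open>c\<close> and
  \<open>d\<close> as the values of \<open>w\<close> at \<open>u = 0\<close> and
  \<open>u = 1\<close>. Closing up after k periods of \<open>u\<close> forces \<open>a\<close> near
  \<open>1/k^2\<close> for small \<open>b\<close>: one period would put \<open>a\<close> near 1,
  where the second radius degenerates; two put it near 1/4, below the value 1/2 at which the mean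
  curvature in the sphere would vanish.\<close>

lemma Ck_on_SucI:
  assumes "\<And>x. (f has_derivative f' x) (at x)" "\<And>v. Ck_on k (\<lambda>x. f' x v) UNIV"
  shows "Ck_on (Suc k) f UNIV"
proof -
  have "frechet_derivative f (at x) = f' x" for x
    using assms(1) frechet_derivative_at by metis
  then show ?thesis
    using assms by (auto simp: differentiable_on_def differentiable_def)
qed

lemma Ck_on_SucD:
  assumes "Ck_on (Suc k) f UNIV"
  shows "(f has_derivative frechet_derivative f (at x)) (at x)"
    "Ck_on k (\<lambda>x. frechet_derivative f (at x) v) UNIV"
  using assms by (auto simp: differentiable_on_def frechet_derivative_works)

text \<open>The product rule leaves one factor undifferentiated; this lemma supplies the regularity
  of that factor one order lower.\<close>

lemma Ck_on_Suc_imp: "Ck_on (Suc k) f S \<Longrightarrow> Ck_on k f S"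
proof (induction k arbitrary: f)
  case 0
  then show ?case by (auto intro: differentiable_imp_continuous_on)
next
  case (Suc k)
  then show ?case by (metis Ck_on.simps(2))
qed

lemma Ck_on_const: "Ck_on k (\<lambda>x. c) UNIV"
proof (induction k arbitrary: c)
  case (Suc k)
  then show ?case by (intro Ck_on_SucI[where f' = "\<lambda>_ _. 0"]) auto
qed auto

lemma Ck_on_bounded_linear:
  assumes "bounded_linear L" shows "Ck_on k L UNIV"
proof (cases k)
  case 0
  then show ?thesis using assms by (auto intro: linear_continuous_on)
next
  case (Suc j)
  then show ?thesis using Ck_on_SucI[of L "\<lambda>_. L"] Ck_on_const bounded_linear_imp_has_derivative[OF assms]
    by blast
qed

lemma Ck_on_linear_compose:
  assumes "bounded_linear L" "Ck_on k f UNIV" shows "Ck_on k (\<lambda>x. L (f x)) UNIV"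
  using assms(2)
proof (induction k arbitrary: f)
  case 0
  then show ?case using assms(1)
    by (auto intro: bounded_linear.continuous_on)
next
  case (Suc k)
  show ?case
    by (rule Ck_on_SucI[OF bounded_linear.has_derivative[OF assms(1) Ck_on_SucD(1)[OF Suc.prems]]])
      (rule Suc.IH[OF Ck_on_SucD(2)[OF Suc.prems]])
qed

lemma Ck_on_add:
  assumes "Ck_on k f UNIV" "Ck_on k g UNIV" shows "Ck_on k (\<lambda>x. f x + g x) UNIV"
  using assms
proof (induction k arbitrary: f g)
  case 0
  then show ?case by (auto intro: continuous_intros)
next
  case (Suc k)
  show ?case
    by (rule Ck_on_SucI[OF has_derivative_add[OF Ck_on_SucD(1)[OF Suc.prems(1)] Ck_on_SucD(1)[OF Suc.prems(2)]]])
      (rule Suc.IH[OF Ck_on_SucD(2)[OF Suc.prems(1)] Ck_on_SucD(2)[OF Suc.prems(2)]])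
qed

lemma Ck_on_bilinear:
  assumes "bounded_bilinear m" "Ck_on k f UNIV" "Ck_on k g UNIV"
  shows "Ck_on k (\<lambda>x. m (f x) (g x)) UNIV"
  using assms(2,3)
proof (induction k arbitrary: f g)
  case 0
  then show ?case using assms(1) by (auto intro: bounded_bilinear.continuous_on)
next
  case (Suc k)
  note d = Ck_on_SucD[OF Suc.prems(1)] Ck_on_SucD[OF Suc.prems(2)]
  show ?case
    by (rule Ck_on_SucI[OF bounded_bilinear.FDERIV[OF assms(1) d(1) d(3)]])
      (intro Ck_on_add Suc.IH d(2,4) Ck_on_Suc_imp[OF Suc.prems(1)] Ck_on_Suc_imp[OF Suc.prems(2)])
qed

lemmas Ck_on_mult = Ck_on_bilinear[OF bounded_bilinear_mult]
lemmas Ck_on_inner = Ck_on_bilinear[OF bounded_bilinear_inner]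
lemmas Ck_on_scaleR = Ck_on_bilinear[OF bounded_bilinear_scaleR]

lemma Ck_on_minus: "Ck_on k f UNIV \<Longrightarrow> Ck_on k (\<lambda>x. - f x) UNIV"
  by (rule Ck_on_linear_compose[OF bounded_linear_minus[OF bounded_linear_ident]])

lemma Ck_on_diff:
  "Ck_on k f UNIV \<Longrightarrow> Ck_on k g UNIV \<Longrightarrow> Ck_on k (\<lambda>x. f x - g x) UNIV"
  using Ck_on_add[of k f "\<lambda>x. - g x"] Ck_on_minus[of k g] by simp

text \<open>The derivative of \<open>1/f\<close> is a product of \<open>1/f\<close>,
  \<open>1/f\<close> and the derivative of \<open>f\<close>, so the induction hypothesis applies to
  \<open>1/f\<close> itself. The square root below works the same way.\<close>

lemma Ck_on_inverse:
  fixes f :: "'a::euclidean_space \<Rightarrow> real"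
  assumes "\<And>x. f x \<noteq> 0" "Ck_on k f UNIV" shows "Ck_on k (\<lambda>x. inverse (f x)) UNIV"
  using assms(2)
proof (induction k)
  case 0
  then show ?case using assms(1) by (auto intro: continuous_intros)
next
  case (Suc k)
  note I = Suc.IH[OF Ck_on_Suc_imp[OF Suc.prems]]
  show ?case
    by (rule Ck_on_SucI[OF Deriv.has_derivative_inverse[OF assms(1) Ck_on_SucD(1)[OF Suc.prems]]])
      (intro Ck_on_mult Ck_on_minus I Ck_on_SucD(2)[OF Suc.prems])
qed

lemma Ck_on_sqrt:
  fixes f :: "'a::euclidean_space \<Rightarrow> real"
  assumes "\<And>x. f x > 0" "Ck_on k f UNIV" shows "Ck_on k (\<lambda>x. sqrt (f x)) UNIV"
  using assms(2)
proof (induction k)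
  case 0
  then show ?case using assms(1) by (auto intro: continuous_intros)
next
  case (Suc k)
  note I = Suc.IH[OF Ck_on_Suc_imp[OF Suc.prems]]
  have s: "sqrt (f x) \<noteq> 0" for x
    using assms(1)[of x] by auto
  show ?case
  proof (rule Ck_on_SucI)
    fix x
    show "((\<lambda>x. sqrt (f x)) has_derivative
        (\<lambda>v. frechet_derivative f (at x) v * (inverse (sqrt (f x)) * (1/2)))) (at x)"
      using has_derivative_real_sqrt[OF assms(1) Ck_on_SucD(1)[OF Suc.prems]]
      by (rule has_derivative_eq_rhs) (auto simp: field_simps)
    show "Ck_on k (\<lambda>x. frechet_derivative f (at x) v * (inverse (sqrt (f x)) * (1/2))) UNIV" for v
      by (intro Ck_on_mult Ck_on_SucD(2)[OF Suc.prems] Ck_on_inverse[OF s] I Ck_on_const)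
  qed
qed

text \<open>Sine and cosine are treated in one induction because each occurs in the derivative of
  the other.\<close>

lemma Ck_on_sin_cos:
  fixes f :: "'a::euclidean_space \<Rightarrow> real"
  assumes "Ck_on k f UNIV"
  shows "Ck_on k (\<lambda>x. sin (f x)) UNIV \<and> Ck_on k (\<lambda>x. cos (f x)) UNIV"
  using assms
proof (induction k)
  case 0
  then show ?case by (auto intro: continuous_intros)
next
  case (Suc k)
  note I = Suc.IH[OF Ck_on_Suc_imp[OF Suc.prems]] and d = Ck_on_SucD[OF Suc.prems]
  have "Ck_on (Suc k) (\<lambda>x. sin (f x)) UNIV"
  proof (rule Ck_on_SucI)
    show "((\<lambda>x. sin (f x)) has_derivative (\<lambda>v. cos (f x) * frechet_derivative f (at x) v)) (at x)" for x
      by (rule has_derivative_eq_rhs[OF has_derivative_sin[OF d(1)]]) auto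
  qed (use I d in \<open>auto intro: Ck_on_mult\<close>)
  moreover have "Ck_on (Suc k) (\<lambda>x. cos (f x)) UNIV"
  proof (rule Ck_on_SucI)
    show "((\<lambda>x. cos (f x)) has_derivative (\<lambda>v. - (sin (f x) * frechet_derivative f (at x) v))) (at x)" for x
      by (rule has_derivative_eq_rhs[OF has_derivative_cos[OF d(1)]]) auto
  qed (intro Ck_on_minus Ck_on_mult conjunct1[OF I] d(2))
  ultimately show ?case ..
qed

lemma Ck_on_cong: "Ck_on k f UNIV \<Longrightarrow> (\<And>x. f x = g x) \<Longrightarrow> Ck_on k g UNIV"
  using ext[of f g] by simp

lemma Ck_on_sum:
  "(\<And>i. i \<in> A \<Longrightarrow> Ck_on k (f i) UNIV) \<Longrightarrow> Ck_on k (\<lambda>x. \<Sum>i\<in>A. f i x) UNIV"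
  by (induction A rule: infinite_finite_induct) (auto intro: Ck_on_const Ck_on_add)

lemma Ck_on_vec:
  fixes f :: "'a::euclidean_space \<Rightarrow> real ^ 'n"
  assumes "\<And>i. Ck_on k (\<lambda>x. f x $ i) UNIV" shows "Ck_on k f UNIV"
proof -
  have "Ck_on k (\<lambda>x. \<Sum>i\<in>UNIV. f x $ i *\<^sub>R axis i (1::real)) UNIV"
    by (intro Ck_on_sum Ck_on_scaleR Ck_on_const assms)
  then show ?thesis
    by (rule Ck_on_cong) (metis vector_space_over_itself.scale_right_distrib basis_expansion scalar_mult_eq_scaleR)
qed

lemma Ck_on_nth: "Ck_on k f UNIV \<Longrightarrow> Ck_on k (\<lambda>x. f x $ i) UNIV"
  by (rule Ck_on_linear_compose[OF bounded_linear_vec_nth])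

lemma has_derivative_vec:
  fixes f :: "'a::euclidean_space \<Rightarrow> real ^ 'n"
  assumes "\<And>i. ((\<lambda>x. f x $ i) has_derivative (\<lambda>v. f' v $ i)) F"
  shows "(f has_derivative f') F"
proof -
  have *: "(\<Sum>i\<in>UNIV. w $ i *\<^sub>R axis i (1::real)) = w" for w :: "real^'n"
    by (metis basis_expansion scalar_mult_eq_scaleR)
  have "((\<lambda>x. \<Sum>i\<in>UNIV. f x $ i *\<^sub>R axis i (1::real)) has_derivative
      (\<lambda>v. \<Sum>i\<in>UNIV. f' v $ i *\<^sub>R axis i 1)) F"
    by (intro has_derivative_sum has_derivative_scaleR_left assms)
  then show ?thesis unfolding * .
qed

lemma has_vector_derivative_compose_has_derivative:
  assumes "(f has_derivative f') (at (g t) within S)" "(g has_vector_derivative v) (at t within A)"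
    "g ` A \<subseteq> S"
  shows "((\<lambda>t. f (g t)) has_vector_derivative f' v) (at t within A)"
  using vector_derivative_diff_chain_within[OF assms(2) has_derivative_subset[OF assms(1,3)]]
  by (simp add: o_def)

section \<open>Directional derivatives and their symmetry\<close>

lemma smooth_on_has_derivative:
  assumes "smooth_on f UNIV" shows "(f has_derivative dir_deriv f p) (at p)"
proof -
  have "Ck_on (Suc 0) f UNIV" using assms smooth_on_def by blast
  from Ck_on_SucD(1)[OF this] show ?thesis unfolding dir_deriv_def .
qed

lemma smooth_on_dir_deriv:
  assumes "smooth_on f UNIV" shows "smooth_on (\<lambda>p. dir_deriv f p v) UNIV"
  using assms Ck_on_SucD(2) unfolding smooth_on_def dir_deriv_def by blast

lemma smooth_on_imp_continuous: "smooth_on f S \<Longrightarrow> continuous_on S f"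
  unfolding smooth_on_def by (metis Ck_on.simps(1))

lemma dir_deriv_eq: "(f has_derivative f') (at p) \<Longrightarrow> dir_deriv f p v = f' v"
  unfolding dir_deriv_def using frechet_derivative_at by metis

text \<open>The mixed derivative in the order \<open>s\<close>, \<open>t\<close> is obtained by differentiating
  \<open>h s t - h s 0 = \<integral>\<^sub>0\<^sup>t h2 s \<tau> d\<tau>\<close> under the integral sign, so one-sided derivatives in \<open>t\<close> suffice.\<close>

lemma mixed_vector_derivatives_eq:
  fixes h :: "real \<Rightarrow> real \<Rightarrow> 'b::banach"
  assumes "0 < d"
    and h2: "\<And>s t. t \<in> {0..d} \<Longrightarrow> (h s has_vector_derivative h2 s t) (at t within {0..d})"
    and h21: "\<And>s t. t \<in> {0..d} \<Longrightarrow> ((\<lambda>s. h2 s t) has_vector_derivative h21 s t) (at s)"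
    and cont: "continuous_on (UNIV \<times> {0..d}) (\<lambda>(s, t). h21 s t)"
    and h1: "\<And>t. t \<in> {0..d} \<Longrightarrow> ((\<lambda>s. h s t) has_vector_derivative h1 t) (at 0)"
    and L: "(h1 has_vector_derivative L) (at 0 within {0..d})"
  shows "L = h21 0 0"
proof -
  have I: "(h2 s has_integral h s t - h s 0) {0..t}" if "t \<in> {0..d}" for s t
    using that
    by (intro fundamental_theorem_of_calculus)
      (auto intro: has_vector_derivative_within_subset[OF h2])
  have eq: "h1 t = h1 0 + integral {0..t} (h21 0)" if t: "t \<in> {0..d}" for t
  proof -
    have "((\<lambda>s. integral (cbox 0 t) (h2 s)) has_vector_derivative integral (cbox 0 t) (h21 0))
        (at 0 within UNIV)"
      using t I[OF t]
      by (intro leibniz_rule_vector_derivative)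
        (auto intro!: h21 has_integral_integrable continuous_on_subset[OF cont] simp: cbox_interval)
    moreover have "integral (cbox 0 t) (h2 s) = h s t - h s 0" for s
      using I[OF t, of s] by (simp add: cbox_interval integral_unique)
    ultimately have "((\<lambda>s. h s t - h s 0) has_vector_derivative integral {0..t} (h21 0)) (at 0)"
      by (simp add: cbox_interval)
    moreover have "((\<lambda>s. h s t - h s 0) has_vector_derivative h1 t - h1 0) (at 0)"
      using t \<open>0 < d\<close> by (intro has_vector_derivative_diff h1) auto
    ultimately have "integral {0..t} (h21 0) = h1 t - h1 0"
      by (rule vector_derivative_unique_at)
    then show ?thesis by simp
  qed
  have "continuous_on {0..d} (h21 0)"
    using continuous_on_compose2[OF cont, of "{0..d}" "\<lambda>t. (0, t)"]
    by (force intro: continuous_intros)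
  then have "((\<lambda>t. h1 0 + integral {0..t} (h21 0)) has_vector_derivative 0 + h21 0 0) (at 0 within {0..d})"
    using \<open>0 < d\<close> by (intro has_vector_derivative_add integral_has_vector_derivative) auto
  then have "(h1 has_vector_derivative 0 + h21 0 0) (at 0 within {0..d})"
    by (rule has_vector_derivative_transform[rotated 2, of _ "0 + h21 0 0"]) (use \<open>0 < d\<close> in simp, erule eq)
  then show ?thesis
    using L \<open>0 < d\<close> vector_derivative_unique_within_closed_interval[of 0 d 0 h1 L "h21 0 0"]
    by (auto simp: cbox_interval)
qed

text \<open>Symmetry of second derivatives, reduced to the two-variable lemma on the plane through
  \<open>p\<close> spanned by \<open>v\<close> and \<open>w\<close>.\<close>

lemma dir_deriv_commute:
  fixes f :: "real ^ 'm \<Rightarrow> 'b::euclidean_space"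
  assumes "smooth_on f UNIV"
  shows "dir_deriv (\<lambda>q. dir_deriv f q v) p w = dir_deriv (\<lambda>q. dir_deriv f q w) p v"
proof -
  define h where "h s t = f (p + s *\<^sub>R v + t *\<^sub>R w)" for s t
  define h2 where "h2 s t = dir_deriv f (p + s *\<^sub>R v + t *\<^sub>R w) w" for s t
  define h21 where "h21 s t = dir_deriv (\<lambda>q. dir_deriv f q w) (p + s *\<^sub>R v + t *\<^sub>R w) v" for s t
  define h1 where "h1 t = dir_deriv f (p + t *\<^sub>R w) v" for t
  note d = smooth_on_has_derivative[OF assms]
  have "(h s has_vector_derivative h2 s t) (at t within {0..1})" for s t
    unfolding h_def h2_def
    by (rule has_vector_derivative_compose_has_derivative[OF d]) (auto intro!: derivative_eq_intros)
  moreover have "((\<lambda>s. h2 s t) has_vector_derivative h21 s t) (at s)" for s t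
    unfolding h2_def h21_def
    by (rule has_vector_derivative_compose_has_derivative[OF smooth_on_has_derivative[OF smooth_on_dir_deriv[OF assms]]])
      (auto intro!: derivative_eq_intros)
  moreover have "continuous_on (UNIV \<times> {0..1}) (\<lambda>(s, t). h21 s t)"
    unfolding split_beta h21_def
    by (rule continuous_on_compose2[OF smooth_on_imp_continuous[OF smooth_on_dir_deriv[OF smooth_on_dir_deriv[OF assms]]]])
      (auto intro!: continuous_intros)
  moreover have "((\<lambda>s. h s t) has_vector_derivative h1 t) (at 0)" for t
  proof -
    have "((\<lambda>s. p + s *\<^sub>R v + t *\<^sub>R w) has_vector_derivative v) (at 0)"
      by (auto intro!: derivative_eq_intros)
    from has_vector_derivative_compose_has_derivative[OF d this] show ?thesis
      by (simp add: h_def h1_def)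
  qed
  moreover have "(h1 has_vector_derivative dir_deriv (\<lambda>q. dir_deriv f q v) p w) (at 0 within {0..1})"
  proof -
    have "((\<lambda>t. p + t *\<^sub>R w) has_vector_derivative w) (at 0 within {0..1})"
      by (auto intro!: derivative_eq_intros)
    from has_vector_derivative_compose_has_derivative[OF
        smooth_on_has_derivative[OF smooth_on_dir_deriv[OF assms, of v]] this] show ?thesis
      by (simp add: h1_def[abs_def])
  qed
  ultimately have "dir_deriv (\<lambda>q. dir_deriv f q v) p w = h21 0 0"
    by (intro mixed_vector_derivatives_eq[of 1 h h2 h21 h1]) auto
  then show ?thesis by (simp add: h21_def)
qed

lemma linear_dir_deriv:
  assumes "smooth_on f UNIV" shows "linear (dir_deriv f p)"
  using smooth_on_has_derivative[OF assms] has_derivative_linear by blast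

lemma linear_vec_expand:
  fixes L :: "real ^ 'm \<Rightarrow> 'b::real_vector"
  assumes "linear L" shows "L v = (\<Sum>i\<in>UNIV. v $ i *\<^sub>R L (axis i 1))"
proof -
  have "(\<Sum>i\<in>UNIV. v $ i *\<^sub>R axis i (1::real)) = v"
    by (metis basis_expansion scalar_mult_eq_scaleR)
  then have "L v = L (\<Sum>i\<in>UNIV. v $ i *\<^sub>R axis i (1::real))" by simp
  also have "\<dots> = (\<Sum>i\<in>UNIV. v $ i *\<^sub>R L (axis i 1))"
    by (simp add: linear_sum[OF assms] linear_cmul[OF assms])
  finally show ?thesis .
qed

text \<open>Both the base point and the direction \<open>Y q\<close> vary; expanding the direction
  in the standard basis turns this into a finite sum of product rules.\<close>

lemma has_derivative_dir_deriv_field: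
  fixes f :: "real ^ 'm \<Rightarrow> 'b::euclidean_space"
  assumes f: "smooth_on f UNIV" and Y: "(Y has_derivative Y') (at p)"
  shows "((\<lambda>q. dir_deriv f q (Y q)) has_derivative
    (\<lambda>w. dir_deriv (\<lambda>q. dir_deriv f q (Y p)) p w + dir_deriv f p (Y' w))) (at p)"
proof -
  have e: "dir_deriv f q u = (\<Sum>i\<in>UNIV. u $ i *\<^sub>R dir_deriv f q (axis i 1))" for q u
    by (rule linear_vec_expand[OF linear_dir_deriv[OF f]])
  note d = smooth_on_has_derivative[OF smooth_on_dir_deriv[OF f]]
  have c: "dir_deriv (\<lambda>q. dir_deriv f q (Y p)) p w =
      (\<Sum>i\<in>UNIV. Y p $ i *\<^sub>R dir_deriv (\<lambda>q. dir_deriv f q (axis i 1)) p w)" for w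
    unfolding e[where u="Y p"]
    by (intro dir_deriv_eq has_derivative_sum has_derivative_scaleR_right d)
  have "((\<lambda>q. \<Sum>i\<in>UNIV. Y q $ i *\<^sub>R dir_deriv f q (axis i 1)) has_derivative
     (\<lambda>w. \<Sum>i\<in>UNIV. Y p $ i *\<^sub>R dir_deriv (\<lambda>q. dir_deriv f q (axis i 1)) p w +
        Y' w $ i *\<^sub>R dir_deriv f p (axis i 1))) (at p)"
    by (intro has_derivative_sum has_derivative_scaleR d bounded_linear.has_derivative[OF bounded_linear_vec_nth Y])
  then show ?thesis
    unfolding c sum.distrib by (subst (1 2) e)
qed

text \<open>The second-order terms of the two iterated derivatives cancel by symmetry; only the
  derivatives of the fields survive, and these form the bracket.\<close>

lemma dir_deriv_lie_bracket:
  fixes f :: "real ^ 'm \<Rightarrow> 'b::euclidean_space"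
  assumes f: "smooth_on f UNIV" and "smooth_on X UNIV" "smooth_on Y UNIV"
  shows "dir_deriv (\<lambda>q. dir_deriv f q (Y q)) p (X p) - dir_deriv (\<lambda>q. dir_deriv f q (X q)) p (Y p)
    = dir_deriv f p (lie_bracket X Y p)"
  unfolding lie_bracket_def linear_diff[OF linear_dir_deriv[OF f]]
    dir_deriv_eq[OF has_derivative_dir_deriv_field[OF f smooth_on_has_derivative[OF assms(2)]]]
    dir_deriv_eq[OF has_derivative_dir_deriv_field[OF f smooth_on_has_derivative[OF assms(3)]]]
    dir_deriv_commute[OF f, of "Y p" p "X p"]
  by simp

section \<open>Tangent and normal spaces\<close>

lemma subspace_tangent_space:
  "linear (dir_deriv F p) \<Longrightarrow> subspace (tangent_space F p)"
  unfolding tangent_space_def by (rule linear_subspace_image) auto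

lemma subspace_normal_space: "subspace (normal_space F p)"
  unfolding normal_space_def by (rule subspace_orthogonal_comp)

lemma normal_space_iff: "n \<in> normal_space F p \<longleftrightarrow> (\<forall>v. dir_deriv F p v \<bullet> n = 0)"
  by (auto simp: normal_space_def tangent_space_def orthogonal_comp_def orthogonal_def)

lemma normal_space_iff_axis:
  assumes "linear (dir_deriv F p)"
  shows "n \<in> normal_space F p \<longleftrightarrow> (\<forall>i. dir_deriv F p (axis i 1) \<bullet> n = 0)"
proof -
  have "dir_deriv F p v \<bullet> n = (\<Sum>i\<in>UNIV. v $ i * (dir_deriv F p (axis i 1) \<bullet> n))" for v
    using arg_cong[OF linear_vec_expand[OF assms, of v], of "\<lambda>x. x \<bullet> n"] by (simp only: inner_sum_left inner_scaleR_left)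
  then show ?thesis unfolding normal_space_iff by (metis (no_types, lifting) mult_zero_right sum.neutral)
qed

lemma normal_tangent_inner: "n \<in> normal_space F p \<Longrightarrow> v \<in> tangent_space F p \<Longrightarrow> n \<bullet> v = 0"
  by (auto simp: normal_space_iff tangent_space_def inner_commute)

text \<open>Two candidates differ by a vector that is both tangent and normal, hence zero.\<close>

lemma normal_part_unique:
  assumes "linear (dir_deriv F p)" "n \<in> normal_space F p" "w - n \<in> tangent_space F p"
  shows "normal_part F p w = n"
  unfolding normal_part_def
proof (rule the_equality)
  fix n' assume n': "n' \<in> normal_space F p \<and> w - n' \<in> tangent_space F p"
  have "(w - n) - (w - n') \<in> tangent_space F p" "n' - n \<in> normal_space F p"
    using n' assms subspace_tangent_space subspace_normal_space subspace_diff by blast+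
  then have "(n' - n) \<bullet> (n' - n) = 0"
    using normal_tangent_inner by fastforce
  then show "n' = n" by simp
qed (use assms in auto)

text \<open>Together with uniqueness, the orthogonal decomposition along the tangent space makes the
  definite description in \<open>normal_part\<close> well defined.\<close>

lemma normal_part:
  assumes "linear (dir_deriv F p)"
  shows normal_part_normal: "normal_part F p w \<in> normal_space F p"
    and normal_part_tangent: "w - normal_part F p w \<in> tangent_space F p"
proof -
  note S = subspace_tangent_space[OF assms]
  obtain y z where *: "y \<in> span (tangent_space F p)"
      "\<And>u. u \<in> span (tangent_space F p) \<Longrightarrow> orthogonal z u" "w = y + z"
    using orthogonal_subspace_decomp_exists by blast
  have sp: "span (tangent_space F p) = tangent_space F p"
    using S by (simp add: span_eq_iff)
  have "orthogonal x z" if "x \<in> tangent_space F p" for x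
    using *(2) that unfolding sp by (simp add: orthogonal_commute)
  moreover have "w - z = y" using *(3) by simp
  ultimately have "z \<in> normal_space F p" "w - z \<in> tangent_space F p"
    using *(1) unfolding sp by (auto simp: normal_space_def orthogonal_comp_def)
  then show "normal_part F p w \<in> normal_space F p" "w - normal_part F p w \<in> tangent_space F p"
    using normal_part_unique[OF assms] by auto
qed

text \<open>Pairing with a normal vector kills the tangential remainder. This is how normal
  components are computed throughout, with no formula for the projection.\<close>

lemma normal_part_inner:
  assumes "linear (dir_deriv F p)" "n \<in> normal_space F p"
  shows "normal_part F p w \<bullet> n = w \<bullet> n"
  using normal_tangent_inner[OF assms(2) normal_part_tangent[OF assms(1), of w]]
  by (simp add: inner_diff_right inner_commute)

lemma normal_part_eq_0_iff:
  assumes "linear (dir_deriv F p)"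
  shows "normal_part F p w = 0 \<longleftrightarrow> w \<in> tangent_space F p"
  using normal_part_unique[OF assms, of 0 w] normal_part_tangent[OF assms, of w]
    subspace_0[OF subspace_normal_space] by auto

section \<open>The mean curvature vector of a surface in coordinates\<close>

definition metric_coeff :: "(real ^ 'm \<Rightarrow> 'a::euclidean_space) \<Rightarrow> 'm \<Rightarrow> 'm \<Rightarrow> real ^ 'm \<Rightarrow> real" where
  "metric_coeff F i j p = dir_deriv F p (axis i 1) \<bullet> dir_deriv F p (axis j 1)"

definition metric_det :: "(real ^ 2 \<Rightarrow> 'a::euclidean_space) \<Rightarrow> real ^ 2 \<Rightarrow> real" where
  "metric_det F p = metric_coeff F 1 1 p * metric_coeff F 2 2 p - (metric_coeff F 1 2 p)\<^sup>2"

definition second_deriv :: "(real ^ 'm \<Rightarrow> 'a::real_normed_vector) \<Rightarrow> 'm \<Rightarrow> 'm \<Rightarrow> real ^ 'm \<Rightarrow> 'a" where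
  "second_deriv F i j p = dir_deriv (\<lambda>q. dir_deriv F q (axis j 1)) p (axis i 1)"

lemma metric_det_pos:
  assumes "linear (dir_deriv F p)" "inj (dir_deriv F p)"
  shows "0 < metric_coeff F 1 1 p" "0 < metric_det F p"
proof -
  let ?a = "dir_deriv F p (axis 1 1)" and ?b = "dir_deriv F p (axis 2 1)"
  have z: "dir_deriv F p v = 0 \<Longrightarrow> v = 0" for v
    using assms linear_injective_0 by blast
  have a: "?a \<noteq> 0" using z[of "axis 1 1"] by (auto simp: axis_eq_0_iff)
  then show E: "0 < metric_coeff F 1 1 p" by (simp add: metric_coeff_def)
  \<comment> \<open>The Gram-Schmidt vector orthogonal to \<open>?a\<close>, scaled to avoid
    division; its image has squared length
    \<open>metric_coeff F 1 1 p * metric_det F p\<close>.\<close>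
  let ?v = "(?a \<bullet> ?a) *\<^sub>R axis 2 1 - (?a \<bullet> ?b) *\<^sub>R axis 1 1 :: real^2"
  have "?v \<noteq> 0" using a by (auto simp: vec_eq_iff axis_def forall_2)
  then have "dir_deriv F p ?v \<noteq> 0" using z by blast
  then have ne: "(?a \<bullet> ?a) *\<^sub>R ?b - (?a \<bullet> ?b) *\<^sub>R ?a \<noteq> 0"
    by (simp add: linear_diff[OF assms(1)] linear_cmul[OF assms(1)])
  have "((?a \<bullet> ?a) *\<^sub>R ?b - (?a \<bullet> ?b) *\<^sub>R ?a) \<bullet> ((?a \<bullet> ?a) *\<^sub>R ?b - (?a \<bullet> ?b) *\<^sub>R ?a)
      = metric_coeff F 1 1 p * metric_det F p"
    unfolding metric_det_def metric_coeff_def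
    by (simp add: inner_diff_left inner_diff_right inner_commute[of ?b ?a] algebra_simps power2_eq_square)
  with ne have "0 < metric_coeff F 1 1 p * metric_det F p" by (metis inner_gt_zero_iff)
  then show "0 < metric_det F p" using E zero_less_mult_pos by blast
qed

lemma matrix_inv_unique:
  fixes A B :: "real ^ 'n ^ 'n"
  assumes "A ** B = mat 1" shows "matrix_inv A = B"
proof -
  have BA: "B ** A = mat 1" using assms matrix_left_right_inverse by blast
  have "A ** matrix_inv A = mat 1 \<and> matrix_inv A ** A = mat 1"
    unfolding matrix_inv_def by (rule someI[of _ B]) (use assms BA in blast)
  then show ?thesis
    by (metis BA matrix_mul_assoc matrix_mul_lid matrix_mul_rid)
qed

text \<open>Tested against a normal vector and cleared of the determinant, the mean curvature
  becomes polynomial in derivatives of \<open>F\<close>: neither the projection nor the inverse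
  matrix remains. In this form it can be differentiated in time.\<close>

lemma mean_curvature_inner:
  fixes F :: "real ^ 2 \<Rightarrow> 'a::euclidean_space"
  assumes "linear (dir_deriv F p)" "inj (dir_deriv F p)"
  shows mean_curvature_normal: "mean_curvature F p \<in> normal_space F p"
    and "n \<in> normal_space F p \<Longrightarrow> metric_det F p * (mean_curvature F p \<bullet> n) =
      metric_coeff F 2 2 p * (second_deriv F 1 1 p \<bullet> n)
      - metric_coeff F 1 2 p * (second_deriv F 1 2 p \<bullet> n + second_deriv F 2 1 p \<bullet> n)
      + metric_coeff F 1 1 p * (second_deriv F 2 2 p \<bullet> n)"
proof -
  define D where "D = metric_det F p"
  have D: "D \<noteq> 0" using metric_det_pos[OF assms] by (simp add: D_def)
  have c21: "metric_coeff F 2 1 p = metric_coeff F 1 2 p"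
    by (simp add: metric_coeff_def inner_commute)
  have g: "induced_metric F p $ i $ j = metric_coeff F i j p" for i j
    by (simp add: induced_metric_def metric_coeff_def coord_field_def)
  \<comment> \<open>The adjugate of the metric divided by its determinant.\<close>
  define B :: "real^2^2" where "B = vector [vector [metric_coeff F 2 2 p / D, - metric_coeff F 1 2 p / D],
      vector [- metric_coeff F 1 2 p / D, metric_coeff F 1 1 p / D]]"
  have "induced_metric F p ** B = mat 1"
    using D by (simp add: vec_eq_iff forall_2 matrix_matrix_mult_def sum_2 g B_def mat_def c21 field_simps)
      (simp add: D_def metric_det_def power2_eq_square algebra_simps)
  then have inv: "matrix_inv (induced_metric F p) = B" by (rule matrix_inv_unique)
  have A: "second_fundamental_form F (coord_field i) (coord_field j) p = normal_part F p (second_deriv F i j p)" for i j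
    by (simp add: second_fundamental_form_def second_deriv_def coord_field_def)
  show "mean_curvature F p \<in> normal_space F p"
    unfolding mean_curvature_def A
    by (intro subspace_sum[OF subspace_normal_space] subspace_scale[OF subspace_normal_space]
        normal_part_normal[OF assms(1)])
  assume n: "n \<in> normal_space F p"
  have "mean_curvature F p \<bullet> n =
      (metric_coeff F 2 2 p * (second_deriv F 1 1 p \<bullet> n)
      - metric_coeff F 1 2 p * (second_deriv F 1 2 p \<bullet> n + second_deriv F 2 1 p \<bullet> n)
      + metric_coeff F 1 1 p * (second_deriv F 2 2 p \<bullet> n)) / D"
    unfolding mean_curvature_def A inv sum_2 B_def
    by (simp add: inner_add_left normal_part_inner[OF assms(1) n] add_divide_distrib diff_divide_distrib
      algebra_simps)
  then show "metric_det F p * (mean_curvature F p \<bullet> n) =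
      metric_coeff F 2 2 p * (second_deriv F 1 1 p \<bullet> n)
      - metric_coeff F 1 2 p * (second_deriv F 1 2 p \<bullet> n + second_deriv F 2 1 p \<bullet> n)
      + metric_coeff F 1 1 p * (second_deriv F 2 2 p \<bullet> n)"
    using D by (simp add: D_def[symmetric])
qed

lemma dir_deriv_inner:
  fixes f g :: "real ^ 'm \<Rightarrow> 'b::euclidean_space"
  assumes "smooth_on f UNIV" "smooth_on g UNIV"
  shows "dir_deriv (\<lambda>q. f q \<bullet> g q) p v = f p \<bullet> dir_deriv g p v + dir_deriv f p v \<bullet> g p"
  by (intro dir_deriv_eq has_derivative_inner smooth_on_has_derivative assms)

lemma smooth_on_inner: "smooth_on f UNIV \<Longrightarrow> smooth_on g UNIV \<Longrightarrow> smooth_on (\<lambda>q. f q \<bullet> g q) UNIV"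
  unfolding smooth_on_def by (blast intro: Ck_on_inner)

lemma dir_deriv_const: "dir_deriv (\<lambda>q. c) p v = 0"
  by (intro dir_deriv_eq[where f'="\<lambda>_. 0"]) auto

lemma torus_immersionD:
  assumes "torus_immersion F"
  shows "smooth_on F UNIV" "linear (dir_deriv F p)" "inj (dir_deriv F p)"
  using assms linear_dir_deriv by (auto simp: torus_immersion_def)

section \<open>Parallel orthonormal frames of the normal bundle\<close>

lemma orthonormal_normal_expand:
  fixes F :: "real ^ 2 \<Rightarrow> real ^ 4"
  assumes L: "linear (dir_deriv F p)" "inj (dir_deriv F p)"
    and e: "e1 \<in> normal_space F p" "e2 \<in> normal_space F p"
    and on: "e1 \<bullet> e1 = 1" "e2 \<bullet> e2 = 1" "e1 \<bullet> e2 = 0" and n: "n \<in> normal_space F p"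
  shows "n = (n \<bullet> e1) *\<^sub>R e1 + (n \<bullet> e2) *\<^sub>R e2"
proof -
  have "dim (tangent_space F p) = 2"
    unfolding tangent_space_def using dim_image_eq[OF L(1), of UNIV] L(2) by simp
  moreover have "dim {y \<in> UNIV. \<forall>x\<in>tangent_space F p. orthogonal x y} + dim (tangent_space F p)
      = dim (UNIV :: (real^4) set)"
    by (rule dim_subspace_orthogonal_to_vectors[OF subspace_tangent_space[OF L(1)]]) auto
  ultimately have dN: "dim (normal_space F p) = 2"
    by (simp add: normal_space_def orthogonal_comp_def)
  have ne: "e1 \<noteq> e2" using on by auto
  have "independent {e1, e2}"
    by (rule pairwise_orthogonal_independent)
      (use on in \<open>auto simp: pairwise_def orthogonal_def inner_commute\<close>)
  then have "dim (span {e1, e2}) = 2" using ne by (simp add: dim_eq_card_independent)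
  then have "span {e1, e2} = normal_space F p"
    using dN span_minimal[OF _ subspace_normal_space, of "{e1, e2}" F p] e
    by (intro subspace_dim_equal subspace_normal_space) simp_all
  then obtain k where k: "n - k *\<^sub>R e1 \<in> span {e2}"
    using n by (metis span_breakdown_eq)
  then obtain l where "n - k *\<^sub>R e1 = l *\<^sub>R e2" by (auto simp: span_singleton)
  then have "n = k *\<^sub>R e1 + l *\<^sub>R e2" by (simp add: algebra_simps)
  then show ?thesis using on by (simp add: inner_add_left inner_commute[of e2 e1])
qed

definition parallel_normal_frame ::
    "(real ^ 'm \<Rightarrow> 'a::euclidean_space) \<Rightarrow> (real ^ 'm \<Rightarrow> 'a) \<Rightarrow> (real ^ 'm \<Rightarrow> 'a) \<Rightarrow> bool" where
  "parallel_normal_frame F e1 e2 \<longleftrightarrow> smooth_on e1 UNIV \<and> smooth_on e2 UNIV \<and>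
     (\<forall>p. e1 p \<in> normal_space F p \<and> e2 p \<in> normal_space F p \<and>
        e1 p \<bullet> e1 p = 1 \<and> e2 p \<bullet> e2 p = 1 \<and> e1 p \<bullet> e2 p = 0 \<and>
        (\<forall>v. dir_deriv e1 p v \<in> tangent_space F p \<and> dir_deriv e2 p v \<in> tangent_space F p))"

text \<open>In the product rule the term with the derivative of \<open>e\<close> drops out, since
  that derivative is tangent and the field is normal. Covariant differentiation thus becomes
  ordinary differentiation of a coefficient.\<close>

lemma normal_connection_inner:
  fixes F :: "real ^ 'm \<Rightarrow> 'a::euclidean_space"
  assumes F: "linear (dir_deriv F p)" and e: "(e has_derivative e') (at p)"
    and n: "e p \<in> normal_space F p" and t: "\<And>v. e' v \<in> tangent_space F p"
    and \<nu>: "(\<nu> has_derivative \<nu>') (at p)" "\<nu> p \<in> normal_space F p"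
  shows "normal_connection F X \<nu> p \<bullet> e p = dir_deriv (\<lambda>q. \<nu> q \<bullet> e q) p (X p)"
proof -
  have "dir_deriv (\<lambda>q. \<nu> q \<bullet> e q) p (X p) = \<nu> p \<bullet> e' (X p) + \<nu>' (X p) \<bullet> e p"
    by (intro dir_deriv_eq has_derivative_inner \<nu> e)
  also have "\<dots> = dir_deriv \<nu> p (X p) \<bullet> e p"
    using normal_tangent_inner[OF \<nu>(2) t] dir_deriv_eq[OF \<nu>(1)] by simp
  finally show ?thesis
    unfolding normal_connection_def normal_part_inner[OF F n] by simp
qed

text \<open>In a parallel frame the curvature acts on the coefficients as the commutator of
  \<open>X\<close> and \<open>Y\<close> minus the derivative along their bracket, which is zero on
  functions.\<close>

lemma flat_normal_bundle_if_parallel_frame: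
  fixes F :: "real ^ 2 \<Rightarrow> real ^ 4"
  assumes F: "torus_immersion F" and fr: "parallel_normal_frame F e1 e2"
  shows "flat_normal_bundle F"
  unfolding flat_normal_bundle_def
proof (intro allI impI)
  fix X Y :: "real ^ 2 \<Rightarrow> real ^ 2" and \<nu> :: "real ^ 2 \<Rightarrow> real ^ 4" and p
  assume X: "torus_vector_field X" and Y: "torus_vector_field Y" and \<nu>: "normal_field F \<nu>"
  note L = torus_immersionD[OF F]
  have sm: "smooth_on X UNIV" "smooth_on Y UNIV" "smooth_on \<nu> UNIV" "smooth_on e1 UNIV" "smooth_on e2 UNIV"
    using X Y \<nu> fr by (auto simp: torus_vector_field_def normal_field_def parallel_normal_frame_def)
  have nu: "\<nu> q \<in> normal_space F q" for q using \<nu> by (auto simp: normal_field_def)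
  have fr': "e1 q \<in> normal_space F q" "e2 q \<in> normal_space F q"
     "e1 q \<bullet> e1 q = 1" "e2 q \<bullet> e2 q = 1" "e1 q \<bullet> e2 q = 0"
     "dir_deriv e1 q v \<in> tangent_space F q" "dir_deriv e2 q v \<in> tangent_space F q" for q v
    using fr by (auto simp: parallel_normal_frame_def)
  note d = smooth_on_has_derivative
  have conn_normal: "normal_connection F Z \<mu> q \<in> normal_space F q" for Z \<mu> q
    unfolding normal_connection_def by (rule normal_part_normal[OF L(2)])
  have expand: "n = (n \<bullet> e1 q) *\<^sub>R e1 q + (n \<bullet> e2 q) *\<^sub>R e2 q" if "n \<in> normal_space F q" for n q
    by (rule orthonormal_normal_expand[OF L(2,3) fr'(1-5) that])
  have conn: "normal_connection F Z \<nu> q \<bullet> e q = dir_deriv (\<lambda>q. \<nu> q \<bullet> e q) q (Z q)"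
    if "e \<in> {e1, e2}" for Z q e
    using that sm fr'
    by (intro normal_connection_inner[where e'="dir_deriv e q" and \<nu>'="dir_deriv \<nu> q"] L(2) d nu) auto
  have ddf: "(\<lambda>q. dir_deriv (\<lambda>q. \<nu> q \<bullet> e q) q (Z q)) differentiable at q"
    if "e \<in> {e1, e2}" "smooth_on Z UNIV" for Z q e
    using has_derivative_dir_deriv_field[OF smooth_on_inner[of \<nu> e] d[OF that(2)], of q] that sm
    unfolding differentiable_def by blast
  \<comment> \<open>The second covariant derivative needs the first one to be differentiable. Its
    definition through the projection does not show this; its expansion in the frame does.\<close>
  have diff: "normal_connection F Z \<nu> differentiable at q" if "smooth_on Z UNIV" for Z q
  proof -
    have "normal_connection F Z \<nu> = (\<lambda>q. dir_deriv (\<lambda>q. \<nu> q \<bullet> e1 q) q (Z q) *\<^sub>R e1 q +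
        dir_deriv (\<lambda>q. \<nu> q \<bullet> e2 q) q (Z q) *\<^sub>R e2 q)"
      using expand[OF conn_normal, of Z \<nu>] conn by (auto simp: fun_eq_iff)
    moreover have "e1 differentiable at q" "e2 differentiable at q"
      using d sm unfolding differentiable_def by blast+
    ultimately show ?thesis
      using ddf[OF _ that] by (simp only:) (intro differentiable_add differentiable_scaleR, auto)
  qed
  have conn2: "normal_connection F X' (normal_connection F Z \<nu>) p \<bullet> e p =
      dir_deriv (\<lambda>q. dir_deriv (\<lambda>q. \<nu> q \<bullet> e q) q (Z q)) p (X' p)"
    if "e \<in> {e1, e2}" "smooth_on Z UNIV" for X' Z e
  proof -
    have "normal_connection F X' (normal_connection F Z \<nu>) p \<bullet> e p =
        dir_deriv (\<lambda>q. normal_connection F Z \<nu> q \<bullet> e q) p (X' p)"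
      using that(1) sm fr'
      by (intro normal_connection_inner[where e'="dir_deriv e p" and
            \<nu>'="frechet_derivative (normal_connection F Z \<nu>) (at p)"] L(2) d conn_normal
          frechet_derivative_works[THEN iffD1, OF diff[OF that(2)]]) auto
    then show ?thesis using conn[OF that(1)] by simp
  qed
  have "normal_curvature F X Y \<nu> p \<bullet> e p = 0" if e: "e \<in> {e1, e2}" for e
  proof -
    have "smooth_on (\<lambda>q. \<nu> q \<bullet> e q) UNIV" using e sm smooth_on_inner by blast
    from dir_deriv_lie_bracket[OF this sm(1,2), of p] show ?thesis
      by (simp add: normal_curvature_def inner_diff_left conn[OF e] conn2[OF e sm(1)] conn2[OF e sm(2)])
  qed
  moreover have "normal_curvature F X Y \<nu> p \<in> normal_space F p"
    unfolding normal_curvature_def by (intro subspace_diff subspace_normal_space conn_normal)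
  ultimately show "normal_curvature F X Y \<nu> p = 0"
    using expand by (metis (no_types, lifting) insertI1 insertI2 scaleR_zero_left add_0)
qed

text \<open>The norm of the mean curvature vector is constant, so the principal normal is again a
  combination of the frame with constant coefficients, and its derivatives are tangent.\<close>

lemma parallel_principal_normal_if_constant_coeffs:
  fixes F :: "real ^ 'm \<Rightarrow> 'a::euclidean_space"
  assumes L: "\<And>p. linear (dir_deriv F p)" and fr: "parallel_normal_frame F e1 e2"
    and H: "\<And>p. mean_curvature F p = a *\<^sub>R e1 p + b *\<^sub>R e2 p"
  shows "parallel_principal_normal F"
  unfolding parallel_principal_normal_def
proof (intro allI impI)
  fix X :: "real ^ 'm \<Rightarrow> real ^ 'm" and p
  define c where "c = inverse (sqrt (a\<^sup>2 + b\<^sup>2))"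
  have "norm (mean_curvature F q) = sqrt (a\<^sup>2 + b\<^sup>2)" for q
    using fr unfolding H norm_eq_sqrt_inner
    by (simp add: parallel_normal_frame_def inner_add_left inner_add_right inner_commute power2_eq_square)
  then have n: "principal_normal F = (\<lambda>q. (c * a) *\<^sub>R e1 q + (c * b) *\<^sub>R e2 q)"
    by (simp add: fun_eq_iff principal_normal_def H c_def scaleR_add_right)
  have "dir_deriv (principal_normal F) p (X p) =
      (c * a) *\<^sub>R dir_deriv e1 p (X p) + (c * b) *\<^sub>R dir_deriv e2 p (X p)"
    unfolding n using fr unfolding parallel_normal_frame_def
    by (intro dir_deriv_eq has_derivative_add has_derivative_scaleR_right smooth_on_has_derivative) auto
  also have "\<dots> \<in> tangent_space F p"
    using fr unfolding parallel_normal_frame_def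
    by (intro subspace_add subspace_scale subspace_tangent_space L) auto
  finally show "normal_connection F X (principal_normal F) p = 0"
    unfolding normal_connection_def normal_part_eq_0_iff[OF L] .
qed

section \<open>Immersions into spheres\<close>

text \<open>Both parts come from differentiating the constant \<open>F \<bullet> F\<close>, once and
  twice.\<close>

lemma spherical_normal:
  fixes F :: "real ^ 'm \<Rightarrow> 'a::euclidean_space"
  assumes "smooth_on F UNIV" "\<And>p. F p \<bullet> F p = r"
  shows "F p \<in> normal_space F p"
    and "second_deriv F i j p \<bullet> F p = - metric_coeff F i j p"
proof -
  have *: "dir_deriv F q v \<bullet> F q = 0" for q v
    using dir_deriv_inner[OF assms(1,1), of q v] unfolding assms(2) dir_deriv_const
    by (simp add: inner_commute)
  then show "F p \<in> normal_space F p" by (simp add: normal_space_iff)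
  show "second_deriv F i j p \<bullet> F p = - metric_coeff F i j p"
    using dir_deriv_inner[OF smooth_on_dir_deriv[OF assms(1), of "axis j 1"] assms(1), of p "axis i 1"]
    unfolding * dir_deriv_const second_deriv_def metric_coeff_def by (simp add: inner_commute)
qed

text \<open>The second fundamental form in the direction of the position vector is minus the metric,
  whose trace on a surface is 2. In particular the mean curvature vector cannot vanish.\<close>

lemma spherical_mean_curvature:
  fixes F :: "real ^ 2 \<Rightarrow> 'a::euclidean_space"
  assumes "torus_immersion F" "\<And>p. F p \<bullet> F p = r"
  shows "mean_curvature F p \<bullet> F p = - 2"
proof -
  note L = torus_immersionD[OF assms(1)] and s = spherical_normal[OF torus_immersionD(1)[OF assms(1)] assms(2)]
  have "metric_coeff F 2 1 p = metric_coeff F 1 2 p" by (simp add: metric_coeff_def inner_commute)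
  then have "metric_det F p * (mean_curvature F p \<bullet> F p) = metric_det F p * (- 2)"
    unfolding mean_curvature_inner(2)[OF L(2,3) s(1)] s(2)
    by (simp add: metric_det_def power2_eq_square algebra_simps)
  moreover have "metric_det F p \<noteq> 0" using metric_det_pos[OF L(2,3), of p] by simp
  ultimately show ?thesis by (metis mult_left_cancel)
qed

text \<open>The product of the principal normal with the position vector is
  \<open>- 2 / |H|\<close>. Its derivative vanishes if the principal normal is parallel: one term
  pairs a tangent vector with the normal vector \<open>F x\<close>, the other a normal vector with
  \<open>dF\<close>.\<close>

lemma spherical_parallel_imp_norm_constant:
  fixes F :: "real ^ 2 \<Rightarrow> 'a::euclidean_space"
  assumes F: "torus_immersion F" and r: "\<And>p. F p \<bullet> F p = r"
    and H: "smooth_on (mean_curvature F) UNIV" and par: "parallel_principal_normal F"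
  shows "norm (mean_curvature F p) = norm (mean_curvature F q)"
proof -
  note L = torus_immersionD[OF F] and s = spherical_normal[OF torus_immersionD(1)[OF F] r]
  have nz: "mean_curvature F x \<noteq> 0" for x
    using spherical_mean_curvature[OF F r, of x] by auto
  define n where "n = principal_normal F"
  have g: "n x \<bullet> F x = - 2 / norm (mean_curvature F x)" for x
    using spherical_mean_curvature[OF F r, of x]
    by (simp add: n_def principal_normal_def divide_inverse)
  have "((\<lambda>x. n x \<bullet> F x) has_derivative (\<lambda>v. 0)) (at x)" for x
  proof -
    have dH: "mean_curvature F differentiable at x"
      using smooth_on_has_derivative[OF H] unfolding differentiable_def by blast
    have "(\<lambda>x. norm (mean_curvature F x)) differentiable at x"
      using differentiable_chain_at[OF dH differentiable_norm_at[OF nz]] by (simp add: o_def)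
    then have "(\<lambda>x. mean_curvature F x /\<^sub>R norm (mean_curvature F x)) differentiable at x"
      using dH nz by (intro differentiable_scaleR differentiable_inverse) auto
    then have "n differentiable at x" unfolding n_def principal_normal_def[abs_def] .
    then have d: "(n has_derivative dir_deriv n x) (at x)"
      unfolding dir_deriv_def[abs_def] by (simp add: frechet_derivative_works)
    have "dir_deriv n x v \<bullet> F x = 0" for v
    proof -
      have "torus_vector_field (\<lambda>_. v)"
        by (auto simp: torus_vector_field_def torus_periodic_def smooth_on_def Ck_on_const)
      then have "normal_part F x (dir_deriv n x v) = 0"
        using par unfolding parallel_principal_normal_def normal_connection_def n_def by blast
      then show ?thesis
        unfolding normal_part_eq_0_iff[OF L(2)] using normal_tangent_inner[OF s(1)]
        by (metis inner_commute)
    qed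
    moreover have "n x \<bullet> dir_deriv F x v = 0" for v
      using mean_curvature_normal[OF L(2,3), of x]
      by (simp add: n_def principal_normal_def normal_space_iff inner_commute)
    ultimately show ?thesis
      using has_derivative_inner[OF d smooth_on_has_derivative[OF L(1)]] by simp
  qed
  then obtain c where "n x \<bullet> F x = c" for x
    using has_derivative_zero_constant[of UNIV "\<lambda>x. n x \<bullet> F x"] by auto
  then have "- 2 / norm (mean_curvature F p) = - 2 / norm (mean_curvature F q)"
    unfolding g by metis
  then show ?thesis using nz by (simp add: field_simps)
qed

text \<open>The triple cross product in four dimensions: up to sign, the cofactors of a determinant
  with rows \<open>u\<close>, \<open>v\<close>, \<open>w\<close> and a free row.\<close>

definition cross4 :: "real ^ 4 \<Rightarrow> real ^ 4 \<Rightarrow> real ^ 4 \<Rightarrow> real ^ 4" where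
  "cross4 u v w = vector [
      u$2 * (v$3 * w$4 - v$4 * w$3) - u$3 * (v$2 * w$4 - v$4 * w$2) + u$4 * (v$2 * w$3 - v$3 * w$2),
    - u$1 * (v$3 * w$4 - v$4 * w$3) + u$3 * (v$1 * w$4 - v$4 * w$1) - u$4 * (v$1 * w$3 - v$3 * w$1),
      u$1 * (v$2 * w$4 - v$4 * w$2) - u$2 * (v$1 * w$4 - v$4 * w$1) + u$4 * (v$1 * w$2 - v$2 * w$1),
    - u$1 * (v$2 * w$3 - v$3 * w$2) + u$2 * (v$1 * w$3 - v$3 * w$1) - u$3 * (v$1 * w$2 - v$2 * w$1)]"

lemma vector_4_nth [simp]:
  "(vector [a, b, c, d] :: 'a::zero ^ 4) $ 1 = a" "(vector [a, b, c, d] :: 'a ^ 4) $ 2 = b"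
  "(vector [a, b, c, d] :: 'a ^ 4) $ 3 = c" "(vector [a, b, c, d] :: 'a ^ 4) $ 4 = d"
  by (simp_all add: vector_def)

lemma inner_real4: "(x :: real ^ 4) \<bullet> y = x$1 * y$1 + x$2 * y$2 + x$3 * y$3 + x$4 * y$4"
  by (simp add: inner_vec_def sum_4)

lemma cross4_orthogonal:
  "u \<bullet> cross4 u v w = 0" "v \<bullet> cross4 u v w = 0" "w \<bullet> cross4 u v w = 0"
  by (simp_all add: inner_real4 cross4_def algebra_simps)

text \<open>The squared length of the triple product is the Gram determinant of its arguments, which
  factors when \<open>w\<close> is orthogonal to the other two.\<close>

lemma cross4_inner_self:
  assumes "u \<bullet> w = 0" "v \<bullet> w = 0"
  shows "cross4 u v w \<bullet> cross4 u v w = (w \<bullet> w) * ((u \<bullet> u) * (v \<bullet> v) - (u \<bullet> v)\<^sup>2)"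
proof -
  have "cross4 u v w \<bullet> cross4 u v w = (u \<bullet> u) * ((v \<bullet> v) * (w \<bullet> w) - (v \<bullet> w) * (v \<bullet> w))
     - (u \<bullet> v) * ((u \<bullet> v) * (w \<bullet> w) - (v \<bullet> w) * (u \<bullet> w))
     + (u \<bullet> w) * ((u \<bullet> v) * (v \<bullet> w) - (v \<bullet> v) * (u \<bullet> w))"
    unfolding inner_real4 cross4_def vector_4_nth by algebra
  then show ?thesis using assms by (simp add: power2_eq_square algebra_simps)
qed

lemma smooth_on_vec:
  fixes f :: "'a::euclidean_space \<Rightarrow> real ^ 'n"
  assumes "\<And>i. smooth_on (\<lambda>x. f x $ i) UNIV" shows "smooth_on f UNIV"
  using assms unfolding smooth_on_def by (blast intro: Ck_on_vec)

lemma smooth_on_cross4: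
  assumes "smooth_on f UNIV" "smooth_on g UNIV" "smooth_on h UNIV"
  shows "smooth_on (\<lambda>x. cross4 (f x) (g x) (h x)) UNIV"
  unfolding smooth_on_def
proof
  fix k
  have "Ck_on k f UNIV" "Ck_on k g UNIV" "Ck_on k h UNIV" using assms by (auto simp: smooth_on_def)
  note n = this[THEN Ck_on_nth]
  have "Ck_on k (\<lambda>x. cross4 (f x) (g x) (h x) $ i) UNIV" for i
    using exhaust_4[of i]
    by (elim disjE; simp only: cross4_def vector_4_nth)
      (intro Ck_on_add Ck_on_diff Ck_on_mult Ck_on_minus n)+
  then show "Ck_on k (\<lambda>x. cross4 (f x) (g x) (h x)) UNIV" by (rule Ck_on_vec)
qed

text \<open>A derivative of \<open>\<nu>\<close> is orthogonal to \<open>\<nu>\<close> because of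
  unit length, and to \<open>F\<close> because \<open>\<nu>\<close> is normal to both
  \<open>F\<close> and \<open>dF\<close>. Since \<open>F\<close> and \<open>\<nu>\<close> span the
  normal space, it is tangent.\<close>

lemma spherical_parallel_normal_frame:
  fixes F \<nu> :: "real ^ 2 \<Rightarrow> real ^ 4"
  assumes F: "torus_immersion F" and r: "\<And>p. F p \<bullet> F p = r" "0 < r"
    and \<nu>: "smooth_on \<nu> UNIV" "\<And>p. \<nu> p \<in> normal_space F p" "\<And>p. \<nu> p \<bullet> \<nu> p = 1" "\<And>p. F p \<bullet> \<nu> p = 0"
  shows "parallel_normal_frame F (\<lambda>p. F p /\<^sub>R sqrt r) \<nu>"
proof -
  note L = torus_immersionD[OF F] and s = spherical_normal[OF torus_immersionD(1)[OF F] r(1)]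
  have n1: "F p /\<^sub>R sqrt r \<in> normal_space F p" for p
    by (intro subspace_scale subspace_normal_space s)
  have on: "(F p /\<^sub>R sqrt r) \<bullet> (F p /\<^sub>R sqrt r) = 1" "(F p /\<^sub>R sqrt r) \<bullet> \<nu> p = 0" for p
    using r \<nu>(4) by (simp_all add: field_simps)
  have "smooth_on (\<lambda>p. F p /\<^sub>R sqrt r) UNIV"
    using L(1) unfolding smooth_on_def by (intro allI Ck_on_scaleR Ck_on_const) auto
  moreover have "dir_deriv (\<lambda>p. F p /\<^sub>R sqrt r) p v = dir_deriv F p (v /\<^sub>R sqrt r)" for p v
    by (subst dir_deriv_eq[OF has_derivative_scaleR_right[OF smooth_on_has_derivative[OF L(1)]]])
      (simp add: linear_cmul[OF L(2)])
  then have "dir_deriv (\<lambda>p. F p /\<^sub>R sqrt r) p v \<in> tangent_space F p" for p v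
    by (auto simp: tangent_space_def)
  moreover have "dir_deriv \<nu> p v \<in> tangent_space F p" for p v
  proof -
    have 1: "dir_deriv \<nu> p v \<bullet> \<nu> p = 0"
      using dir_deriv_inner[OF \<nu>(1,1), of p v] unfolding \<nu>(3) dir_deriv_const
      by (simp add: inner_commute)
    have "F p \<bullet> dir_deriv \<nu> p v = 0"
      using dir_deriv_inner[OF L(1) \<nu>(1), of p v] \<nu>(2)[of p] unfolding \<nu>(4) dir_deriv_const
      by (simp add: normal_space_iff)
    then have 2: "dir_deriv \<nu> p v \<bullet> (F p /\<^sub>R sqrt r) = 0" by (simp add: inner_commute)
    have "normal_part F p (dir_deriv \<nu> p v) = 0"
      using orthonormal_normal_expand[OF L(2,3) n1 \<nu>(2) on(1) \<nu>(3) on(2) normal_part_normal[OF L(2)],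
          of p "dir_deriv \<nu> p v"]
      unfolding normal_part_inner[OF L(2) n1] normal_part_inner[OF L(2) \<nu>(2)] 1 2 by simp
    then show ?thesis by (simp add: normal_part_eq_0_iff[OF L(2)])
  qed
  ultimately show ?thesis
    unfolding parallel_normal_frame_def using \<nu> n1 on by blast
qed

text \<open>The unit normal within the sphere is the normalised triple product of the two coordinate
  vectors and the position vector; its squared length \<open>r * metric_det F p\<close> is
  positive.\<close>

lemma spherical_flat_normal_bundle:
  fixes F :: "real ^ 2 \<Rightarrow> real ^ 4"
  assumes F: "torus_immersion F" and r: "\<And>p. F p \<bullet> F p = r" "0 < r"
  shows "flat_normal_bundle F"
proof -
  note L = torus_immersionD[OF F] and s = spherical_normal[OF torus_immersionD(1)[OF F] r(1)]
  define b where "b p = cross4 (dir_deriv F p (axis 1 1)) (dir_deriv F p (axis 2 1)) (F p)" for p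
  define \<nu> where "\<nu> p = inverse (sqrt (b p \<bullet> b p)) *\<^sub>R b p" for p
  have z: "dir_deriv F p v \<bullet> F p = 0" for p v using s(1) by (simp add: normal_space_iff)
  have "b p \<bullet> b p = r * metric_det F p" for p
    unfolding b_def cross4_inner_self[OF z z] metric_det_def metric_coeff_def r(1) ..
  then have pos: "b p \<bullet> b p > 0" for p using r metric_det_pos[OF L(2,3)] by simp
  have sm: "smooth_on b UNIV" unfolding b_def by (intro smooth_on_cross4 smooth_on_dir_deriv L(1))
  have ne: "sqrt (b p \<bullet> b p) \<noteq> 0" for p using pos[of p] by auto
  have "smooth_on \<nu> UNIV"
    unfolding smooth_on_def \<nu>_def
  proof
    fix k
    show "Ck_on k (\<lambda>p. inverse (sqrt (b p \<bullet> b p)) *\<^sub>R b p) UNIV"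
      using sm by (intro Ck_on_scaleR Ck_on_inverse[OF ne] Ck_on_sqrt[OF pos] Ck_on_inner)
        (auto simp: smooth_on_def)
  qed
  moreover have "\<nu> p \<in> normal_space F p" for p
  proof -
    have "dir_deriv F p (axis i 1) \<bullet> b p = 0" for i
      using exhaust_2[of i] cross4_orthogonal by (auto simp: b_def)
    then show ?thesis
      unfolding normal_space_iff_axis[OF L(2)] \<nu>_def by simp
  qed
  moreover have "\<nu> p \<bullet> \<nu> p = 1" for p
    using pos[of p] by (simp add: \<nu>_def field_simps)
  moreover have "F p \<bullet> \<nu> p = 0" for p
    by (simp add: \<nu>_def b_def cross4_orthogonal)
  ultimately show ?thesis
    using flat_normal_bundle_if_parallel_frame[OF F spherical_parallel_normal_frame[OF F r]] by blast
qed

section \<open>Mean curvature flow\<close>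

lemma second_derivative_nonpos_at_max:
  fixes h h1 :: "real \<Rightarrow> real"
  assumes h1: "\<And>x. (h has_real_derivative h1 x) (at x)" and c: "(h1 has_real_derivative c) (at 0)"
    and max: "\<And>x. h x \<le> h 0"
  shows "h1 0 = 0" "c \<le> 0"
proof -
  show z: "h1 0 = 0" by (rule DERIV_local_max[OF h1, of 1]) (use max in auto)
  show "c \<le> 0"
  proof (rule ccontr)
    assume "\<not> c \<le> 0"
    then obtain d where d: "d > 0" "\<And>k. k > 0 \<Longrightarrow> k < d \<Longrightarrow> h1 0 < h1 (0 + k)"
      using has_real_derivative_pos_inc_right[OF c] by auto
    obtain x where x: "0 < x" "x < d / 2" "h (d / 2) - h 0 = (d / 2 - 0) * h1 x"
      using MVT2[of 0 "d / 2" h h1] h1 d(1) by auto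
    then have "h1 x > 0" using d(2)[of x] z by simp
    then have "(d / 2 - 0) * h1 x > 0" using d(1) by simp
    then show False using x(3) max[of "d / 2"] by linarith
  qed
qed

lemma second_deriv_direction:
  fixes F :: "real ^ 2 \<Rightarrow> 'a::euclidean_space"
  assumes F: "smooth_on F UNIV"
  shows "dir_deriv (\<lambda>q. dir_deriv F q v) p v = (v$1)\<^sup>2 *\<^sub>R second_deriv F 1 1 p +
    (v$1 * v$2) *\<^sub>R (second_deriv F 1 2 p + second_deriv F 2 1 p) + (v$2)\<^sup>2 *\<^sub>R second_deriv F 2 2 p"
proof -
  have "(\<lambda>q. dir_deriv F q v) = (\<lambda>q. \<Sum>j\<in>UNIV. v $ j *\<^sub>R dir_deriv F q (axis j 1))"
    using linear_vec_expand[OF linear_dir_deriv[OF F]] by blast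
  then have *: "dir_deriv (\<lambda>q. dir_deriv F q v) p v
      = (\<Sum>j\<in>UNIV. v $ j *\<^sub>R dir_deriv (\<lambda>q. dir_deriv F q (axis j 1)) p v)"
    by (simp only:) (intro dir_deriv_eq has_derivative_sum has_derivative_scaleR_right
        smooth_on_has_derivative smooth_on_dir_deriv F)
  have "dir_deriv (\<lambda>q. dir_deriv F q (axis j 1)) p v = (\<Sum>i\<in>UNIV. v $ i *\<^sub>R second_deriv F i j p)" for j
    unfolding second_deriv_def by (rule linear_vec_expand[OF linear_dir_deriv[OF smooth_on_dir_deriv[OF F]]])
  then show ?thesis
    by (simp add: * sum_2 power2_eq_square scaleR_add_right mult.commute)
qed

text \<open>Half the Laplacian of \<open>|F|^2\<close> is \<open>H \<bullet> F + 2\<close>, and it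
  is nonpositive at a maximum. The factor \<open>s\<close> covers maxima and minima at once.\<close>

lemma mean_curvature_inner_at_max:
  fixes F :: "real ^ 2 \<Rightarrow> 'a::euclidean_space"
  assumes F: "torus_immersion F" and max: "\<And>q. s * (F q \<bullet> F q) \<le> s * (F p \<bullet> F p)" and s: "s \<noteq> 0"
  shows "s * (mean_curvature F p \<bullet> F p + 2) \<le> 0"
proof -
  note L = torus_immersionD[OF F] and d = smooth_on_has_derivative[OF torus_immersionD(1)[OF F]]
  have *: "dir_deriv F p v \<bullet> F p = 0 \<and>
      s * (dir_deriv (\<lambda>q. dir_deriv F q v) p v \<bullet> F p + dir_deriv F p v \<bullet> dir_deriv F p v) \<le> 0" for v
  proof -
    define h where "h x = s * (F (p + x *\<^sub>R v) \<bullet> F (p + x *\<^sub>R v))" for x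
    define h1 where "h1 x = 2 * s * (dir_deriv F (p + x *\<^sub>R v) v \<bullet> F (p + x *\<^sub>R v))" for x
    have g: "((\<lambda>x. p + x *\<^sub>R v) has_vector_derivative v) (at x)" for x
      by (auto intro!: derivative_eq_intros)
    have F1: "((\<lambda>x. F (p + x *\<^sub>R v)) has_vector_derivative dir_deriv F (p + x *\<^sub>R v) v) (at x)" for x
      by (rule has_vector_derivative_compose_has_derivative[OF d g]) simp
    have F2: "((\<lambda>x. dir_deriv F (p + x *\<^sub>R v) v) has_vector_derivative
        dir_deriv (\<lambda>q. dir_deriv F q v) (p + x *\<^sub>R v) v) (at x)" for x
      by (rule has_vector_derivative_compose_has_derivative[OF smooth_on_has_derivative[OF smooth_on_dir_deriv[OF L(1)]] g]) simp
    have "(h has_real_derivative h1 x) (at x)" for x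
      unfolding h_def h1_def has_real_derivative_iff_has_vector_derivative
      by (rule has_vector_derivative_eq_rhs[OF has_vector_derivative_mult_right[OF
              bounded_bilinear.has_vector_derivative[OF bounded_bilinear_inner F1 F1]]])
        (simp add: inner_commute)
    moreover have "(h1 has_real_derivative 2 * s * (dir_deriv F (p + 0 *\<^sub>R v) v \<bullet> dir_deriv F (p + 0 *\<^sub>R v) v
        + dir_deriv (\<lambda>q. dir_deriv F q v) (p + 0 *\<^sub>R v) v \<bullet> F (p + 0 *\<^sub>R v))) (at 0)"
      unfolding h1_def has_real_derivative_iff_has_vector_derivative
      by (rule has_vector_derivative_mult_right[OF
              bounded_bilinear.has_vector_derivative[OF bounded_bilinear_inner F2 F1]])
    moreover have "h x \<le> h 0" for x using max by (simp add: h_def)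
    ultimately show ?thesis
      using second_derivative_nonpos_at_max[of h h1] s by (fastforce simp: h1_def algebra_simps)
  qed
  define g11 g12 g22 D where g: "g11 = metric_coeff F 1 1 p" "g12 = metric_coeff F 1 2 p"
    "g22 = metric_coeff F 2 2 p" "D = metric_det F p"
  have pos: "g11 > 0" "D > 0" using metric_det_pos[OF L(2,3)] by (auto simp: g)
  have D: "D = g11 * g22 - g12\<^sup>2" by (simp add: g metric_det_def)
  have nF: "F p \<in> normal_space F p" using * by (simp add: normal_space_iff)
  note H = mean_curvature_inner(2)[OF L(2,3) nF, folded g]
  \<comment> \<open>In the induced metric \<open>v\<close> is orthogonal to the first coordinate
    direction and has squared length \<open>g11 * D\<close>. The second-derivative tests along
    \<open>axis 1 1\<close> and \<open>v\<close>, with weights \<open>D\<close> and 1, therefore add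
    up to the trace.\<close>
  define v :: "real^2" where "v = vector [- g12, g11]"
  have v: "v$1 = - g12" "v$2 = g11" by (simp_all add: v_def)
  have A: "s * (second_deriv F 1 1 p \<bullet> F p + g11) \<le> 0"
    using *[of "axis 1 1"] by (simp add: second_deriv_def g metric_coeff_def)
  have dv: "dir_deriv F p v = (- g12) *\<^sub>R dir_deriv F p (axis 1 1) + g11 *\<^sub>R dir_deriv F p (axis 2 1)"
    by (subst linear_vec_expand[OF L(2)]) (simp add: sum_2 v)
  have "dir_deriv F p v \<bullet> dir_deriv F p v = g12\<^sup>2 * g11 - 2 * g12 * g11 * g12 + g11\<^sup>2 * g22"
    unfolding dv g metric_coeff_def
    by (simp add: inner_diff_left inner_diff_right inner_commute power2_eq_square algebra_simps)
  also have "\<dots> = g11 * D" by (simp add: D power2_eq_square algebra_simps)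
  finally have vv: "dir_deriv F p v \<bullet> dir_deriv F p v = g11 * D" .
  have B: "s * (g12\<^sup>2 * (second_deriv F 1 1 p \<bullet> F p)
      - g12 * g11 * (second_deriv F 1 2 p \<bullet> F p + second_deriv F 2 1 p \<bullet> F p)
      + g11\<^sup>2 * (second_deriv F 2 2 p \<bullet> F p) + g11 * D) \<le> 0"
    using *[of v] unfolding vv second_deriv_direction[OF L(1)] v
    by (simp add: inner_add_left inner_diff_left algebra_simps)
  have "(g11 * D) * (s * (mean_curvature F p \<bullet> F p + 2)) = g11 * s * (D * (mean_curvature F p \<bullet> F p)) + 2 * g11 * s * D"
    by (simp add: algebra_simps)
  also have "\<dots> = D * (s * (second_deriv F 1 1 p \<bullet> F p + g11)) +
      s * (g12\<^sup>2 * (second_deriv F 1 1 p \<bullet> F p)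
      - g12 * g11 * (second_deriv F 1 2 p \<bullet> F p + second_deriv F 2 1 p \<bullet> F p)
      + g11\<^sup>2 * (second_deriv F 2 2 p \<bullet> F p) + g11 * D)"
    unfolding H by (simp add: D power2_eq_square algebra_simps)
  also have "\<dots> \<le> 0" using A B pos by (simp add: mult_nonneg_nonpos add_nonpos_nonpos)
  finally show ?thesis using pos by (simp add: mult_le_0_iff)
qed

text \<open>At an endpoint of the time interval \<open>I\<close> the derivative in time is one-sided.\<close>

definition slice_deriv ::
  "real set \<Rightarrow> ((real ^ 'm) \<times> real \<Rightarrow> 'b::real_normed_vector) \<Rightarrow> (real ^ 'm) \<times> real \<Rightarrow> (real ^ 'm) \<times> real \<Rightarrow> 'b" where
  "slice_deriv I g u z = frechet_derivative g (at z within UNIV \<times> I) u"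

lemma smooth_on_slice_deriv: "smooth_on g (UNIV \<times> I) \<Longrightarrow> smooth_on (slice_deriv I g u) (UNIV \<times> I)"
  unfolding smooth_on_def slice_deriv_def[abs_def] by (metis Ck_on.simps(2))

lemma has_derivative_slice_deriv:
  assumes "smooth_on g (UNIV \<times> I)" "t \<in> I"
  shows "(g has_derivative (\<lambda>u. slice_deriv I g u (p, t))) (at (p, t) within UNIV \<times> I)"
proof -
  have "Ck_on (Suc 0) g (UNIV \<times> I)" using assms by (simp only: smooth_on_def)
  then show ?thesis
    using assms(2) unfolding slice_deriv_def
    by (auto simp: differentiable_on_def frechet_derivative_works[symmetric])
qed

lemma has_derivative_space_slice:
  assumes "smooth_on g (UNIV \<times> I)" "t \<in> I"
  shows "((\<lambda>q. g (q, t)) has_derivative (\<lambda>v. slice_deriv I g (v, 0) (p, t))) (at p)"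
proof -
  have "((\<lambda>q. (q, t)) has_derivative (\<lambda>v. (v, 0))) (at p)"
    by (auto intro!: derivative_eq_intros)
  moreover have "(g has_derivative (\<lambda>u. slice_deriv I g u (p, t))) (at (p, t) within range (\<lambda>q. (q, t)))"
    by (rule has_derivative_subset[OF has_derivative_slice_deriv[OF assms]]) (use assms(2) in auto)
  ultimately show ?thesis
    using diff_chain_within[of "\<lambda>q. (q, t)" _ p UNIV g] by (simp add: o_def)
qed

lemma has_vector_derivative_time_slice:
  assumes "smooth_on g (UNIV \<times> I)" "t \<in> I"
  shows "((\<lambda>s. g (p, s)) has_vector_derivative slice_deriv I g (0, 1) (p, t)) (at t within I)"
  by (rule has_vector_derivative_compose_has_derivative[where g="Pair p", OF has_derivative_slice_deriv[OF assms]])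
    (auto intro!: derivative_eq_intros simp: has_vector_derivative_def)

lemma smooth_on_space_slice:
  fixes g :: "(real ^ 'm) \<times> real \<Rightarrow> 'b::real_normed_vector"
  assumes "smooth_on g (UNIV \<times> I)" "t \<in> I"
  shows "smooth_on (\<lambda>q. g (q, t)) UNIV"
proof -
  have "Ck_on k (\<lambda>q. g (q, t)) UNIV" for k
    using assms(1)
  proof (induction k arbitrary: g)
    case 0
    then show ?case
      using smooth_on_imp_continuous[OF 0] assms(2)
      by (auto intro!: continuous_on_compose2[of "UNIV \<times> I" g] continuous_intros)
  next
    case (Suc k)
    show ?case
      by (rule Ck_on_SucI[OF has_derivative_space_slice[OF Suc.prems assms(2)]])
        (rule Suc.IH[OF smooth_on_slice_deriv[OF Suc.prems]])
  qed
  then show ?thesis by (simp add: smooth_on_def)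
qed

text \<open>Time 0 is the endpoint of the time interval, so the space and time derivatives are
  exchanged by the version of the symmetry lemma that is one-sided in time.\<close>

lemma slice_deriv_commute_at_0:
  fixes g :: "(real ^ 'm) \<times> real \<Rightarrow> 'b::euclidean_space"
  assumes g: "smooth_on g (UNIV \<times> I)" and d: "0 < d" "{0..d} \<subseteq> I"
  shows "slice_deriv I (slice_deriv I g (v, 0)) (0, 1) (p, 0) = slice_deriv I (slice_deriv I g (0, 1)) (v, 0) (p, 0)"
proof -
  define h where "h s t = g (p + s *\<^sub>R v, t)" for s t
  define h2 where "h2 s t = slice_deriv I g (0, 1) (p + s *\<^sub>R v, t)" for s t
  define h21 where "h21 s t = slice_deriv I (slice_deriv I g (0, 1)) (v, 0) (p + s *\<^sub>R v, t)" for s t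
  define h1 where "h1 t = slice_deriv I g (v, 0) (p, t)" for t
  note sm = smooth_on_slice_deriv
  have l: "((\<lambda>s. p + s *\<^sub>R v) has_vector_derivative v) (at s)" for s
    by (auto intro!: derivative_eq_intros)
  have tI: "t \<in> I" if "t \<in> {0..d}" for t using that d(2) by blast
  have "(h s has_vector_derivative h2 s t) (at t within {0..d})" if "t \<in> {0..d}" for s t
    unfolding h_def h2_def
    by (rule has_vector_derivative_within_subset[OF has_vector_derivative_time_slice[OF g tI[OF that]] d(2)])
  moreover have "((\<lambda>s. h2 s t) has_vector_derivative h21 s t) (at s)" if "t \<in> {0..d}" for s t
    unfolding h2_def h21_def
    by (rule has_vector_derivative_compose_has_derivative[OF has_derivative_space_slice[OF sm[OF g] tI[OF that]] l]) simp
  moreover have "continuous_on (UNIV \<times> {0..d}) (\<lambda>(s, t). h21 s t)"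
    unfolding split_beta h21_def
    by (rule continuous_on_compose2[OF smooth_on_imp_continuous[OF sm[OF sm[OF g]]]])
      (use tI in \<open>auto intro!: continuous_intros\<close>)
  moreover have "((\<lambda>s. h s t) has_vector_derivative h1 t) (at 0)" if "t \<in> {0..d}" for t
    using has_vector_derivative_compose_has_derivative[OF has_derivative_space_slice[OF g tI[OF that]] l[of 0]]
    by (simp add: h_def h1_def)
  moreover have "(h1 has_vector_derivative slice_deriv I (slice_deriv I g (v, 0)) (0, 1) (p, 0)) (at 0 within {0..d})"
    unfolding h1_def
    by (rule has_vector_derivative_within_subset[OF has_vector_derivative_time_slice[OF sm[OF g] tI] d(2)])
      (use d in auto)
  ultimately have "slice_deriv I (slice_deriv I g (v, 0)) (0, 1) (p, 0) = h21 0 0"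
    by (intro mixed_vector_derivatives_eq[OF d(1), of h h2 h21 h1]) auto
  then show ?thesis by (simp add: h21_def)
qed

section \<open>Times of the flow and regularity of its mean curvature vector\<close>

definition flow_times :: "ereal \<Rightarrow> real set" where
  "flow_times T = {t. 0 \<le> t \<and> ereal t < T}"

lemma flow_times_interval: "t \<in> flow_times T \<Longrightarrow> {0..t} \<subseteq> flow_times T"
  by (auto simp: flow_times_def intro: le_less_trans[of "ereal _" "ereal t"])

text \<open>The time interval is open on the right, so each of its times lies in a nondegenerate
  closed interval \<open>{0..t'}\<close> inside it, where one-sided derivatives are unique.\<close>

lemma flow_times_extend:
  assumes "t \<in> flow_times T" obtains t' where "t < t'" "t' \<in> flow_times T"
  using assms ereal_dense2[of "ereal t" T] by (auto simp: flow_times_def)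

lemma vector_derivative_unique_flow_times:
  assumes "t \<in> flow_times T" "(f has_vector_derivative a) (at t within flow_times T)"
    "(f has_vector_derivative b) (at t within flow_times T)"
  shows "a = b"
proof -
  obtain t' where t': "t < t'" "t' \<in> flow_times T" using flow_times_extend[OF assms(1)] .
  note s = has_vector_derivative_within_subset[OF _ flow_times_interval[OF t'(2)]]
  have "0 < t'" "t \<in> {0..t'}" using t' assms(1) by (auto simp: flow_times_def)
  then show ?thesis
    using vector_derivative_unique_within_closed_interval[of 0 t' t f a b] s[OF assms(2)] s[OF assms(3)]
    by (simp add: cbox_interval)
qed

lemma mean_curvature_flowD:
  assumes "mean_curvature_flow F0 T F"
  shows "0 \<in> flow_times T" "smooth_on (\<lambda>(p, t). F t p) (UNIV \<times> flow_times T)" "F 0 = F0"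
    and "t \<in> flow_times T \<Longrightarrow> torus_immersion (F t)"
    and "t \<in> flow_times T \<Longrightarrow>
      ((\<lambda>s. F s p) has_vector_derivative mean_curvature (F t) p) (at t within flow_times T)"
  using assms by (auto simp: mean_curvature_flow_def Let_def flow_times_def zero_ereal_def)

lemma mean_curvature_flow_slice_deriv:
  assumes "mean_curvature_flow F0 T F" "t \<in> flow_times T"
  shows "mean_curvature (F t) p = slice_deriv (flow_times T) (\<lambda>(p, t). F t p) (0, 1) (p, t)"
  using has_vector_derivative_time_slice[OF mean_curvature_flowD(2)[OF assms(1)] assms(2), of p]
  by (intro vector_derivative_unique_flow_times[OF assms(2) mean_curvature_flowD(5)[OF assms]]) simp

text \<open>Smoothness is read off the flow equation: the mean curvature vector is the time
  derivative of a smooth map.\<close>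

lemma smooth_on_mean_curvature_flow:
  assumes "mean_curvature_flow F0 T F" "t \<in> flow_times T"
  shows "smooth_on (mean_curvature (F t)) UNIV"
proof -
  have "mean_curvature (F t) = (\<lambda>q. slice_deriv (flow_times T) (\<lambda>(p, t). F t p) (0, 1) (q, t))"
    using mean_curvature_flow_slice_deriv[OF assms] by blast
  then show ?thesis
    using smooth_on_space_slice[OF smooth_on_slice_deriv[OF mean_curvature_flowD(2)[OF assms(1)]] assms(2)]
    by simp
qed

section \<open>Preservation of the shrinking spheres\<close>

lemma int_lattice_reduce:
  fixes p :: "real ^ 'm"
  obtains q where "q \<in> cbox 0 (vec 1)" "p - q \<in> int_lattice"
proof
  let ?q = "\<chi> i. frac (p $ i)"
  show "?q \<in> cbox 0 (vec 1)"
    by (auto simp: mem_box_cart frac_lt_1 less_imp_le)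
  show "p - ?q \<in> int_lattice"
    by (auto simp: int_lattice_def frac_def)
qed

lemma torus_periodic_reduce:
  fixes p :: "real ^ 'm"
  obtains q where "q \<in> cbox 0 (vec 1)" "\<And>f :: real ^ 'm \<Rightarrow> 'a. torus_periodic f \<Longrightarrow> f p = f q"
proof -
  obtain q where "q \<in> cbox 0 (vec 1)" "p - q \<in> int_lattice" by (rule int_lattice_reduce)
  moreover from this have "f p = f q" if "torus_periodic f" for f :: "real ^ 'm \<Rightarrow> 'a"
    using that by (metis torus_periodic_def add.commute diff_add_cancel)
  ultimately show thesis using that by blast
qed

text \<open>At a spatial maximum of \<open>s * |F|^2\<close> the quantity
  \<open>s * (|F|^2 + 4 * t)\<close> has nonpositive time derivative. By periodicity the maximum
  over all of space and \<open>{0..t}\<close> is attained on a compact box.\<close>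

lemma mean_curvature_flow_sphere_bound:
  fixes F0 :: "real ^ 2 \<Rightarrow> 'a::euclidean_space"
  assumes flow: "mean_curvature_flow F0 T F" and 1: "\<And>p. F0 p \<bullet> F0 p = 1" and t: "t \<in> flow_times T"
    and s: "s \<noteq> 0"
  shows "s * (F t p \<bullet> F t p + 4 * t - 1) \<le> 0"
proof (rule ccontr)
  note fl = mean_curvature_flowD[OF flow]
  define A where "A = s * (F t p \<bullet> F t p + 4 * t - 1)"
  \<comment> \<open>The penalty \<open>\<epsilon> * \<tau>\<close> makes the time derivative
    strictly negative at the maximum. Since \<open>\<epsilon> * t < A\<close>, the function
    \<open>W\<close> is still positive at \<open>(p, t)\<close>, while it vanishes at time 0; so the
    maximum occurs at positive time.\<close>
  define \<epsilon> where "\<epsilon> = A / (2 * (t + 1))"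
  assume "\<not> s * (F t p \<bullet> F t p + 4 * t - 1) \<le> 0"
  then have A: "A > 0" by (simp add: A_def)
  have t0: "0 \<le> t" using t by (simp add: flow_times_def)
  have \<epsilon>: "\<epsilon> > 0" using A t0 by (simp add: \<epsilon>_def)
  define W where "W q \<tau> = s * (F \<tau> q \<bullet> F \<tau> q + 4 * \<tau> - 1) - \<epsilon> * \<tau>" for q \<tau>
  have "\<epsilon> * t < A" using A t0 by (simp add: \<epsilon>_def field_simps add_nonneg_pos)
  then have Wp: "W p t > 0" by (simp add: W_def A_def)
  let ?K = "cbox 0 (vec 1) \<times> {0..t} :: ((real^2) \<times> real) set"
  have "continuous_on ?K (\<lambda>(q, \<tau>). F \<tau> q)"
    by (rule continuous_on_subset[OF smooth_on_imp_continuous[OF fl(2)]])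
      (use flow_times_interval[OF t] in auto)
  then have "continuous_on ?K (\<lambda>(q, \<tau>). W q \<tau>)"
    unfolding W_def split_beta by (intro continuous_intros)
  moreover have "compact ?K" by (intro compact_Times compact_cbox compact_Icc)
  moreover have "(0, 0) \<in> ?K" using t0 by (simp add: mem_box_cart)
  then have "?K \<noteq> {}" by blast
  ultimately obtain z where z: "z \<in> ?K" "\<And>y. y \<in> ?K \<Longrightarrow> (\<lambda>(q, \<tau>). W q \<tau>) y \<le> (\<lambda>(q, \<tau>). W q \<tau>) z"
    using continuous_attains_sup by metis
  obtain q \<tau> where q: "z = (q, \<tau>)" by fastforce
  have \<tau>: "\<tau> \<in> {0..t}" "\<tau> \<in> flow_times T" using z(1) flow_times_interval[OF t] by (auto simp: q)
  have max: "W q' \<tau>' \<le> W q \<tau>" if "\<tau>' \<in> {0..t}" for q' \<tau>'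
  proof -
    obtain r where r: "r \<in> cbox 0 (vec 1)" "\<And>f :: real^2 \<Rightarrow> 'a. torus_periodic f \<Longrightarrow> f q' = f r"
      using torus_periodic_reduce[of q'] by blast
    have "torus_periodic (F \<tau>')"
      using fl(4)[of \<tau>'] that flow_times_interval[OF t] by (auto simp: torus_immersion_def)
    then have "F \<tau>' q' = F \<tau>' r" by (rule r(2))
    then have "W q' \<tau>' = W r \<tau>'" by (simp only: W_def)
    then show ?thesis using z(2)[of "(r, \<tau>')"] r(1) that by (simp add: q)
  qed
  have "W q \<tau> > 0" using max[of t p] Wp t0 by simp
  then have "\<tau> \<noteq> 0" using 1 fl(3) by (auto simp: W_def)
  then have \<tau>0: "\<tau> > 0" using \<tau> by simp
  have "s * (F \<tau> r \<bullet> F \<tau> r) \<le> s * (F \<tau> q \<bullet> F \<tau> q)" for r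
    using max[OF \<tau>(1), of r] by (simp add: W_def algebra_simps)
  from mean_curvature_inner_at_max[OF fl(4)[OF \<tau>(2)] this s]
  have neg: "s * (2 * (mean_curvature (F \<tau>) q \<bullet> F \<tau> q) + 4) - \<epsilon> < 0"
    using \<epsilon> by (simp add: algebra_simps)
  \<comment> \<open>Only the past of \<open>\<tau>\<close> enters, so a maximum at the final time
    \<open>t\<close> is covered: a negative left derivative gives larger values of \<open>W\<close>
    shortly before \<open>\<tau>\<close>.\<close>
  have d: "((\<lambda>\<tau>. F \<tau> q) has_vector_derivative mean_curvature (F \<tau>) q) (at \<tau> within {0..\<tau>})"
    by (rule has_vector_derivative_within_subset[OF fl(5)[OF \<tau>(2)] flow_times_interval[OF \<tau>(2)]])
  have "((\<lambda>\<tau>. F \<tau> q \<bullet> F \<tau> q) has_real_derivative 2 * (mean_curvature (F \<tau>) q \<bullet> F \<tau> q)) (at \<tau> within {0..\<tau>})"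
    unfolding has_real_derivative_iff_has_vector_derivative
    by (rule has_vector_derivative_eq_rhs[OF bounded_bilinear.has_vector_derivative[OF bounded_bilinear_inner d d]])
      (simp add: inner_commute)
  then have "(W q has_real_derivative s * (2 * (mean_curvature (F \<tau>) q \<bullet> F \<tau> q) + 4) - \<epsilon>) (at \<tau> within {0..\<tau>})"
    unfolding W_def[abs_def] by (auto intro!: derivative_eq_intros)
  from has_real_derivative_neg_dec_left[OF this neg]
  obtain e where e: "e > 0" "\<And>h. h > 0 \<Longrightarrow> \<tau> - h \<in> {0..\<tau>} \<Longrightarrow> h < e \<Longrightarrow> W q \<tau> < W q (\<tau> - h)" by blast
  have "W q \<tau> < W q (\<tau> - min (e/2) \<tau>)" using e(1) \<tau>0 by (intro e(2)) auto
  moreover have "\<tau> - min (e/2) \<tau> \<in> {0..t}" using \<tau> e(1) \<tau>0 by auto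
  ultimately show False using max by (meson not_le)
qed

lemma mean_curvature_flow_sphere:
  fixes F0 :: "real ^ 2 \<Rightarrow> 'a::euclidean_space"
  assumes "mean_curvature_flow F0 T F" "\<And>p. F0 p \<bullet> F0 p = 1" "t \<in> flow_times T"
  shows "F t p \<bullet> F t p = 1 - 4 * t"
  using mean_curvature_flow_sphere_bound[OF assms, of 1 p] mean_curvature_flow_sphere_bound[OF assms, of "-1" p]
  by simp

text \<open>At radius zero the position vector would vanish, against its product \<open>- 2\<close>
  with the mean curvature vector. Hence every flow ends no later than time 1/4.\<close>

lemma mean_curvature_flow_sphere_radius_pos:
  fixes F0 :: "real ^ 2 \<Rightarrow> 'a::euclidean_space"
  assumes flow: "mean_curvature_flow F0 T F" and 1: "\<And>p. F0 p \<bullet> F0 p = 1" and t: "t \<in> flow_times T"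
  shows "0 < 1 - 4 * t"
proof -
  note e = mean_curvature_flow_sphere[OF assms]
  have "mean_curvature (F t) 0 \<bullet> F t 0 = - 2"
    by (rule spherical_mean_curvature[OF mean_curvature_flowD(4)[OF flow t] e])
  then have "F t 0 \<noteq> 0" by auto
  then show ?thesis using e[of 0] by (metis inner_gt_zero_iff)
qed

text \<open>This is the evolution equation \<open>\<partial>\<^sub>t |H|\<^sup>2 = \<Delta>|H|\<^sup>2 - 2|\<nabla>\<^sup>\<bottom>H|\<^sup>2 + 2|A\<^sup>H|\<^sup>2\<close> at a time where \<open>H\<close> is parallel of
  constant length; \<open>l 1\<close> and \<open>l 2\<close> are the eigenvalues of the shape operator \<open>A\<^sup>H\<close>.\<close>

lemma mean_curvature_flow_norm_derivative:
  fixes F0 :: "real ^ 2 \<Rightarrow> 'a::euclidean_space"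
  assumes flow: "mean_curvature_flow F0 T F" and orth: "metric_coeff F0 1 2 p = 0"
    and shape: "\<And>i. dir_deriv (mean_curvature F0) p (axis i 1) = - l i *\<^sub>R dir_deriv F0 p (axis i 1)"
    and const: "\<And>q. mean_curvature F0 q \<bullet> mean_curvature F0 q = c"
  shows "((\<lambda>t. mean_curvature (F t) p \<bullet> mean_curvature (F t) p) has_real_derivative
    2 * ((l 1)\<^sup>2 + (l 2)\<^sup>2)) (at 0 within flow_times T)"
proof -
  note fl = mean_curvature_flowD[OF flow]
  define I where "I = flow_times T"
  define g where "g = (\<lambda>(p, t). F t p)"
  have I0: "0 \<in> I" using fl(1) by (simp add: I_def)
  obtain d where d: "0 < d" "{0..d} \<subseteq> I"
    using flow_times_extend[OF fl(1)] flow_times_interval I_def by metis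
  have g: "smooth_on g (UNIV \<times> I)" using fl(2) by (simp add: g_def I_def)
  note sd = smooth_on_slice_deriv and im = torus_immersionD[OF fl(4), folded I_def]
  define ee where "ee i = (axis i 1 :: real^2, 0 :: real)" for i
  define a where "a i t = dir_deriv (F t) p (axis i 1)" for i t
  define b where "b i j t = second_deriv (F t) i j p" for i j t
  define H where "H t = mean_curvature (F t) p" for t
  have sm: "smooth_on F0 UNIV" "smooth_on (mean_curvature F0) UNIV"
    using im(1)[OF I0] smooth_on_mean_curvature_flow[OF flow fl(1)] fl(3) by auto
  have dF: "dir_deriv (F t) q (axis i 1) = slice_deriv I g (ee i) (q, t)" if "t \<in> I" for q t i
    using dir_deriv_eq[OF has_derivative_space_slice[OF g that]] by (simp add: g_def ee_def)
  have ddF: "second_deriv (F t) i j q = slice_deriv I (slice_deriv I g (ee j)) (ee i) (q, t)" if "t \<in> I" for q t i j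
    unfolding second_deriv_def dF[OF that]
    using dir_deriv_eq[OF has_derivative_space_slice[OF sd[OF g] that]] by (simp add: ee_def)
  have Ht: "mean_curvature (F t) q = slice_deriv I g (0, 1) (q, t)" if "t \<in> I" for q t
    using mean_curvature_flow_slice_deriv[OF flow] that by (simp add: g_def I_def)
  have dH: "dir_deriv (mean_curvature F0) q (axis i 1) = slice_deriv I (slice_deriv I g (ee i)) (0, 1) (q, 0)" for q i
  proof -
    have "mean_curvature F0 = (\<lambda>q. slice_deriv I g (0, 1) (q, 0))" using Ht[OF I0] fl(3) by auto
    then show ?thesis
      using dir_deriv_eq[OF has_derivative_space_slice[OF sd[OF g] I0], of "(0, 1)" q "axis i 1"]
        slice_deriv_commute_at_0[OF g d, of "axis i 1" q] by (simp add: ee_def)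
  qed
  have ddH: "second_deriv (mean_curvature F0) i j p =
      slice_deriv I (slice_deriv I (slice_deriv I g (ee j)) (ee i)) (0, 1) (p, 0)" for i j
  proof -
    have "second_deriv (mean_curvature F0) i j p
        = slice_deriv I (slice_deriv I (slice_deriv I g (ee j)) (0, 1)) (ee i) (p, 0)"
      unfolding second_deriv_def dH
      using dir_deriv_eq[OF has_derivative_space_slice[OF sd[OF sd[OF g]] I0]] by (simp add: ee_def)
    then show ?thesis
      using slice_deriv_commute_at_0[OF sd[OF g] d, of _ "axis i 1" p] by (simp add: ee_def)
  qed
  \<comment> \<open>The time derivative of a coordinate vector is the space derivative of
    \<open>H\<close>, which \<open>shape\<close> makes a multiple of the same vector.\<close>
  have a': "(a i has_vector_derivative - l i *\<^sub>R a i 0) (at 0 within I)" for i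
  proof -
    have "((\<lambda>t. slice_deriv I g (ee i) (p, t)) has_vector_derivative - l i *\<^sub>R a i 0) (at 0 within I)"
      using has_vector_derivative_time_slice[OF sd[OF g] I0, of "ee i" p] dH[where q=p] shape fl(3)
      by (simp add: a_def)
    then show ?thesis
      by (rule has_vector_derivative_transform[OF I0, rotated]) (simp add: a_def dF)
  qed
  have b': "(b i j has_vector_derivative second_deriv (mean_curvature F0) i j p) (at 0 within I)" for i j
    using has_vector_derivative_time_slice[OF sd[OF sd[OF g]] I0, where p=p] unfolding ddH
    by (rule has_vector_derivative_transform[OF I0, rotated]) (simp add: b_def ddF)
  obtain H' where H': "(H has_vector_derivative H') (at 0 within I)"
  proof
    show "(H has_vector_derivative slice_deriv I (slice_deriv I g (0, 1)) (0, 1) (p, 0)) (at 0 within I)"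
      using has_vector_derivative_time_slice[OF sd[OF g] I0, where p=p]
      by (rule has_vector_derivative_transform[OF I0, rotated]) (simp add: H_def Ht)
  qed
  have inn: "((\<lambda>t. u t \<bullet> w t) has_real_derivative u 0 \<bullet> w' + u' \<bullet> w 0) (at 0 within I)"
    if "(u has_vector_derivative u') (at 0 within I)" "(w has_vector_derivative w') (at 0 within I)"
    for u w :: "real \<Rightarrow> 'a" and u' w'
    unfolding has_real_derivative_iff_has_vector_derivative
    by (rule bounded_bilinear.has_vector_derivative[OF bounded_bilinear_inner that])
  have uniq: "x = y" if "(f has_real_derivative x) (at 0 within I)" "(h has_real_derivative y) (at 0 within I)"
    "\<And>t. t \<in> I \<Longrightarrow> f t = h t" for x y and f h :: "real \<Rightarrow> real"
  proof -
    have "(f has_vector_derivative y) (at 0 within I)"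
      by (rule has_vector_derivative_transform[OF I0 that(3)])
        (use that(2) in \<open>simp_all add: has_real_derivative_iff_has_vector_derivative\<close>)
    then show ?thesis
      using vector_derivative_unique_flow_times[OF fl(1)] that(1)
      by (simp add: has_real_derivative_iff_has_vector_derivative I_def)
  qed
  have Hn: "H t \<in> normal_space (F t) p" if "t \<in> I" for t
    unfolding H_def by (rule mean_curvature_normal[OF im(2,3)[OF that]])
  have aH: "a i t \<bullet> H t = 0" if "t \<in> I" for i t
    using Hn[OF that] by (simp add: normal_space_iff a_def)
  \<comment> \<open>The product of \<open>dF\<close> with \<open>H\<close> vanishes identically in
    space; this is its derivative in direction \<open>i\<close>.\<close>
  have bH: "b i i 0 \<bullet> H 0 = l i * (a i 0 \<bullet> a i 0)" for i
  proof -
    have "(\<lambda>q. dir_deriv F0 q (axis i 1) \<bullet> mean_curvature F0 q) = (\<lambda>q. 0)"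
      using mean_curvature_normal[OF im(2,3)[OF I0]] fl(3) by (auto simp: normal_space_iff)
    then have "dir_deriv F0 p (axis i 1) \<bullet> dir_deriv (mean_curvature F0) p (axis i 1)
        + second_deriv F0 i i p \<bullet> mean_curvature F0 p = 0"
      using dir_deriv_inner[OF smooth_on_dir_deriv[OF sm(1), of "axis i 1"] sm(2), of p "axis i 1"]
      by (simp add: dir_deriv_const second_deriv_def)
    then show ?thesis
      using fl(3) by (simp add: shape b_def H_def a_def)
  qed
  \<comment> \<open>Differentiating the constant \<open>|H|^2\<close> twice trades the second
    derivative of \<open>H\<close> for the square of the first, which \<open>shape\<close>
    evaluates.\<close>
  have b'H: "second_deriv (mean_curvature F0) i i p \<bullet> H 0 = - (l i)\<^sup>2 * (a i 0 \<bullet> a i 0)" for i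
  proof -
    have "mean_curvature F0 q \<bullet> dir_deriv (mean_curvature F0) q v = 0" for q v
      using dir_deriv_inner[OF sm(2,2), of q v] unfolding const dir_deriv_const by (simp add: inner_commute)
    then have "(\<lambda>q. mean_curvature F0 q \<bullet> dir_deriv (mean_curvature F0) q (axis i 1)) = (\<lambda>q. 0)" by blast
    then have "mean_curvature F0 p \<bullet> second_deriv (mean_curvature F0) i i p
        + dir_deriv (mean_curvature F0) p (axis i 1) \<bullet> dir_deriv (mean_curvature F0) p (axis i 1) = 0"
      using dir_deriv_inner[OF sm(2) smooth_on_dir_deriv[OF sm(2), of "axis i 1"], of p "axis i 1"]
      by (simp add: dir_deriv_const second_deriv_def)
    then show ?thesis
      using fl(3) by (simp add: shape H_def a_def inner_commute power2_eq_square)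
  qed
  \<comment> \<open>The relation \<open>aH\<close> is differentiated in time; the term with the
    derivative of \<open>a i\<close> vanishes, as that derivative is still a multiple of
    \<open>a i 0\<close>.\<close>
  have H'n: "H' \<in> normal_space (F 0) p"
    unfolding normal_space_iff_axis[OF im(2)[OF I0]]
  proof
    fix i
    have "a i 0 \<bullet> H' + (- l i *\<^sub>R a i 0) \<bullet> H 0 = 0"
      by (rule uniq[OF inn[OF a' H'] _ aH]) auto
    then show "dir_deriv (F 0) p (axis i 1) \<bullet> H' = 0"
      using aH[OF I0, of i] by (simp add: a_def)
  qed
  define E where "E = a 1 0 \<bullet> a 1 0"
  define G where "G = a 2 0 \<bullet> a 2 0"
  define x where "x = H 0 \<bullet> H'"
  have M0: "a 1 0 \<bullet> a 2 0 = 0" using orth fl(3) by (simp add: metric_coeff_def a_def)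
  have pos: "E \<noteq> 0" "G \<noteq> 0"
    using metric_det_pos[OF im(2,3)[OF I0], of p] orth fl(3)
    by (auto simp: E_def G_def a_def metric_coeff_def metric_det_def)
  have eqn: "((a 1 t \<bullet> a 1 t) * (a 2 t \<bullet> a 2 t) - (a 1 t \<bullet> a 2 t)\<^sup>2) * (H t \<bullet> n) =
      (a 2 t \<bullet> a 2 t) * (b 1 1 t \<bullet> n) - (a 1 t \<bullet> a 2 t) * (b 1 2 t \<bullet> n + b 2 1 t \<bullet> n)
      + (a 1 t \<bullet> a 1 t) * (b 2 2 t \<bullet> n)" if "t \<in> I" "n \<in> normal_space (F t) p" for t n
    using mean_curvature_inner(2)[OF im(2,3)[OF that(1)] that(2)]
    by (simp add: metric_det_def metric_coeff_def a_def b_def H_def)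
  have H'eq: "E * G * x = G * (b 1 1 0 \<bullet> H') + E * (b 2 2 0 \<bullet> H')"
    using eqn[OF I0 H'n] by (simp add: M0 E_def G_def x_def)
  have N: "H 0 \<bullet> H 0 = l 1 + l 2"
  proof -
    have "(E * G) * (H 0 \<bullet> H 0) = (E * G) * (l 1 + l 2)"
      using eqn[OF I0 Hn[OF I0]] by (simp add: M0 bH algebra_simps flip: E_def G_def)
    then show ?thesis using pos by simp
  qed
  have dE: "((\<lambda>t. a 1 t \<bullet> a 1 t) has_real_derivative - 2 * l 1 * E) (at 0 within I)"
    and dG: "((\<lambda>t. a 2 t \<bullet> a 2 t) has_real_derivative - 2 * l 2 * G) (at 0 within I)"
    using inn[OF a' a', of 1 1] inn[OF a' a', of 2 2] by (simp_all add: E_def G_def mult.assoc)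
  have dM: "((\<lambda>t. a 1 t \<bullet> a 2 t) has_real_derivative 0) (at 0 within I)"
    using inn[OF a' a', of 1 2] by (simp add: M0)
  have dN: "((\<lambda>t. H t \<bullet> H t) has_real_derivative 2 * x) (at 0 within I)"
    using inn[OF H' H'] by (simp add: x_def inner_commute)
  have dD: "((\<lambda>t. (a 1 t \<bullet> a 1 t) * (a 2 t \<bullet> a 2 t) - (a 1 t \<bullet> a 2 t)\<^sup>2) has_real_derivative
      - 2 * (l 1 + l 2) * (E * G)) (at 0 within I)"
    by (rule derivative_eq_intros dE dG dM refl)+ (simp add: E_def G_def M0 algebra_simps)
  \<comment> \<open>Both sides of \<open>eqn\<close> for \<open>n = H t\<close> are differentiated
    at 0. The right side brings in products of \<open>b\<close> with the unknown \<open>H'\<close>;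
    they are eliminated by \<open>H'eq\<close>, the same equation at time 0 with
    \<open>n = H'\<close>.\<close>
  have "((\<lambda>t. ((a 1 t \<bullet> a 1 t) * (a 2 t \<bullet> a 2 t) - (a 1 t \<bullet> a 2 t)\<^sup>2) * (H t \<bullet> H t)) has_real_derivative
      - 2 * (l 1 + l 2) * (E * G) * (l 1 + l 2) + 2 * x * (E * G)) (at 0 within I)"
    using DERIV_mult[OF dD dN] by (simp add: N M0 E_def G_def)
  moreover have "((\<lambda>t. (a 2 t \<bullet> a 2 t) * (b 1 1 t \<bullet> H t) - (a 1 t \<bullet> a 2 t) * (b 1 2 t \<bullet> H t + b 2 1 t \<bullet> H t)
      + (a 1 t \<bullet> a 1 t) * (b 2 2 t \<bullet> H t)) has_real_derivative
      - 4 * l 1 * l 2 * (E * G) + G * (b 1 1 0 \<bullet> H' - (l 1)\<^sup>2 * E) + E * (b 2 2 0 \<bullet> H' - (l 2)\<^sup>2 * G)) (at 0 within I)"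
    by (rule derivative_eq_intros dE dG dM inn[OF b' H'] refl)+
      (simp add: M0 bH b'H algebra_simps flip: E_def G_def)
  ultimately have "- 2 * (l 1 + l 2) * (E * G) * (l 1 + l 2) + 2 * x * (E * G) =
      - 4 * l 1 * l 2 * (E * G) + G * (b 1 1 0 \<bullet> H' - (l 1)\<^sup>2 * E) + E * (b 2 2 0 \<bullet> H' - (l 2)\<^sup>2 * G)"
    by (rule uniq) (rule eqn[OF _ Hn])
  then have "(E * G) * x = (E * G) * ((l 1)\<^sup>2 + (l 2)\<^sup>2)"
    using H'eq by (simp add: algebra_simps power2_eq_square)
  then have "x = (l 1)\<^sup>2 + (l 2)\<^sup>2" using pos by simp
  then show ?thesis using dN by (simp add: H_def I_def)
qed

section \<open>Loss of the parallel principal normal\<close>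

lemma eventually_ne_at_right_if_derivative_ne:
  fixes f g :: "real \<Rightarrow> real"
  assumes "(f has_real_derivative f') (at 0 within S)" "(g has_real_derivative g') (at 0 within S)"
    and "f 0 = g 0" "f' \<noteq> g'"
  obtains d where "d > 0" "\<And>t. 0 < t \<Longrightarrow> t < d \<Longrightarrow> t \<in> S \<Longrightarrow> f t \<noteq> g t"
proof -
  have d: "((\<lambda>t. f t - g t) has_real_derivative f' - g') (at 0 within S)"
    by (rule DERIV_diff[OF assms(1,2)])
  consider "f' - g' > 0" | "f' - g' < 0" using assms(4) by linarith
  then show thesis
  proof cases
    case 1
    from has_real_derivative_pos_inc_right[OF d 1] show thesis
      using that assms(3) by fastforce
  next
    case 2
    from has_real_derivative_neg_dec_right[OF d 2] show thesis
      using that assms(3) by fastforce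
  qed
qed

text \<open>At \<open>p\<close> and \<open>q\<close> the values of \<open>|H|^2\<close> agree at
  time 0 but grow at different rates, so they differ shortly afterwards; on a sphere this excludes a
  parallel principal normal.\<close>

lemma mean_curvature_flow_spherical:
  fixes F0 :: "real ^ 2 \<Rightarrow> real ^ 4"
  assumes flow: "mean_curvature_flow F0 T F" and 1: "\<And>p. F0 p \<bullet> F0 p = 1"
    and orth: "\<And>p. metric_coeff F0 1 2 p = 0"
    and shape: "\<And>p i. dir_deriv (mean_curvature F0) p (axis i 1) = - l i p *\<^sub>R dir_deriv F0 p (axis i 1)"
    and const: "\<And>q. mean_curvature F0 q \<bullet> mean_curvature F0 q = c"
    and ne: "(l 1 p)\<^sup>2 + (l 2 p)\<^sup>2 \<noteq> (l 1 q)\<^sup>2 + (l 2 q)\<^sup>2"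
  shows "\<exists>\<delta>. 0 < \<delta> \<and> ereal \<delta> < T \<and>
      (\<forall>t\<in>{0<..<\<delta>}. nowhere_vanishing_mean_curvature (F t) \<and> \<not> parallel_principal_normal (F t))"
    and "0 \<le> t \<Longrightarrow> ereal t < T \<Longrightarrow> flat_normal_bundle (F t)"
proof -
  note fl = mean_curvature_flowD[OF flow] and e = mean_curvature_flow_sphere[OF flow 1]
  show "flat_normal_bundle (F t)" if "0 \<le> t" "ereal t < T"
  proof -
    have t: "t \<in> flow_times T" using that by (simp add: flow_times_def)
    show ?thesis
      by (rule spherical_flat_normal_bundle[OF fl(4)[OF t] e[OF t]
            mean_curvature_flow_sphere_radius_pos[OF flow 1 t]])
  qed
  define N where "N r t = mean_curvature (F t) r \<bullet> mean_curvature (F t) r" for r t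
  have dN: "(N r has_real_derivative 2 * ((l 1 r)\<^sup>2 + (l 2 r)\<^sup>2)) (at 0 within flow_times T)" for r
    unfolding N_def[abs_def]
    by (rule mean_curvature_flow_norm_derivative[OF flow orth shape const])
  obtain d where d: "d > 0" "\<And>t. 0 < t \<Longrightarrow> t < d \<Longrightarrow> t \<in> flow_times T \<Longrightarrow> N p t \<noteq> N q t"
    using eventually_ne_at_right_if_derivative_ne[OF dN[of p] dN[of q]] ne fl(3) const
    by (auto simp: N_def)
  obtain d' where d': "0 < d'" "d' \<in> flow_times T" using flow_times_extend[OF fl(1)] by blast
  show "\<exists>\<delta>. 0 < \<delta> \<and> ereal \<delta> < T \<and>
      (\<forall>t\<in>{0<..<\<delta>}. nowhere_vanishing_mean_curvature (F t) \<and> \<not> parallel_principal_normal (F t))"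
  proof (intro exI conjI ballI)
    have "min d d' \<in> flow_times T" using d d' flow_times_interval[OF d'(2)] by auto
    then show "ereal (min d d') < T" by (simp add: flow_times_def)
    show "0 < min d d'" using d d' by simp
    fix t assume t: "t \<in> {0<..<min d d'}"
    then have tI: "t \<in> flow_times T" using flow_times_interval[OF d'(2)] by auto
    have "mean_curvature (F t) r \<noteq> 0" for r
      using spherical_mean_curvature[OF fl(4)[OF tI] e[OF tI], of r] by auto
    then show "nowhere_vanishing_mean_curvature (F t)"
      by (simp add: nowhere_vanishing_mean_curvature_def)
    show "\<not> parallel_principal_normal (F t)"
    proof
      assume "parallel_principal_normal (F t)"
      from spherical_parallel_imp_norm_constant[OF fl(4)[OF tI] e[OF tI]
          smooth_on_mean_curvature_flow[OF flow tI] this]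
      have "N p t = N q t" by (simp add: N_def flip: power2_norm_eq_inner)
      then show False using d(2)[of t] t tI by simp
    qed
  qed
qed

section \<open>The period problem\<close>

lemma antiderivative_real:
  fixes f :: "real \<Rightarrow> real"
  assumes "continuous_on UNIV f"
  obtains F where "\<And>x. (F has_real_derivative f x) (at x)"
proof -
  have "isCont f x" for x using assms by (simp add: continuous_on_eq_continuous_at)
  then have "\<exists>F. \<forall>x :: real. - \<infinity> < ereal x \<longrightarrow> ereal x < \<infinity> \<longrightarrow> (F has_vector_derivative f x) (at x)"
    by (intro einterval_antiderivative) auto
  then show thesis using that by (auto simp: has_real_derivative_iff_has_vector_derivative)
qed

text \<open>The increment over one period has derivative zero, so it equals its value at 0.\<close>

lemma antiderivative_periodic:
  fixes f F :: "real \<Rightarrow> real"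
  assumes F: "\<And>x. (F has_real_derivative f x) (at x)" and per: "\<And>x. f (x + 1) = f x"
  shows "F (x + 1) = F x + integral {0..1} f"
proof -
  have "((\<lambda>x. F (x + 1) - F x) has_real_derivative f (x + 1) * 1 - f x) (at x)" for x
    by (intro DERIV_diff F DERIV_chain2[OF F]) (auto intro!: derivative_eq_intros)
  then have "((\<lambda>x. F (x + 1) - F x) has_real_derivative 0) (at x)" for x by (simp add: per)
  then have "F (x + 1) - F x = F (0 + 1) - F 0" by (intro DERIV_isconst_all[of "\<lambda>x. F (x + 1) - F x"] allI)
  moreover have "(f has_integral F 1 - F 0) {0..1}"
    using F by (intro fundamental_theorem_of_calculus)
      (auto simp: has_real_derivative_iff_has_vector_derivative intro: has_vector_derivative_at_within)
  then have "integral {0..1} f = F 1 - F 0" by (rule integral_unique)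
  ultimately show ?thesis by simp
qed

definition profile :: "real \<Rightarrow> real \<Rightarrow> real \<Rightarrow> real" where
  "profile a b x = a + b * cos (4 * pi * x)"

text \<open>The speed of the angle \<open>\<phi>\<close>, divided by \<open>2 * pi\<close> and split
  into partial fractions. The first term decreases and the second increases with the profile, and
  both are monotone in \<open>c\<close> and \<open>d\<close>, which makes interval bounds
  easy.\<close>

definition angular_speed :: "real \<Rightarrow> real \<Rightarrow> real \<Rightarrow> real \<Rightarrow> real \<Rightarrow> real" where
  "angular_speed c d a b x = c / sqrt (profile a b x) + d * sqrt (profile a b x) / (1 - profile a b x)"

lemma profile_bounds:
  assumes "0 \<le> b" shows "a - b \<le> profile a b x" "profile a b x \<le> a + b"
proof -
  have "b * (-1) \<le> b * cos (4 * pi * x)" "b * cos (4 * pi * x) \<le> b * 1"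
    using assms cos_ge_minus_one cos_le_one by (intro mult_left_mono; simp)+
  then show "a - b \<le> profile a b x" "profile a b x \<le> a + b" by (auto simp: profile_def)
qed

lemma angular_speed_bounds:
  assumes b: "0 \<le> b" and l: "0 < l" "l\<^sup>2 \<le> a - b" and m: "0 < m" "a + b \<le> m\<^sup>2" "m\<^sup>2 < 1"
    and c: "0 \<le> c0" "c0 \<le> c" "c \<le> c1" and d: "0 \<le> d0" "d0 \<le> d" "d \<le> d1"
  shows "c0 / m + d0 * l / (1 - l\<^sup>2) \<le> angular_speed c d a b x"
    "angular_speed c d a b x \<le> c1 / l + d1 * m / (1 - m\<^sup>2)"
proof -
  let ?u = "profile a b x"
  have u: "l\<^sup>2 \<le> ?u" "?u \<le> m\<^sup>2" using profile_bounds[OF b, of a x] l m by linarith+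
  then have s: "l \<le> sqrt ?u" "sqrt ?u \<le> m" "0 < ?u"
    using l m by (simp_all add: real_le_rsqrt real_le_lsqrt less_le_trans[of 0 "l\<^sup>2"])
  show "c0 / m + d0 * l / (1 - l\<^sup>2) \<le> angular_speed c d a b x"
    unfolding angular_speed_def using u s c d l m
    by (intro add_mono frac_le mult_mono mult_nonneg_nonneg) auto
  show "angular_speed c d a b x \<le> c1 / l + d1 * m / (1 - m\<^sup>2)"
    unfolding angular_speed_def using u s c d l m
    by (intro add_mono frac_le mult_mono mult_nonneg_nonneg) auto
qed

lemma integral_unit_le:
  fixes f :: "real \<Rightarrow> real"
  assumes "continuous_on UNIV f" "\<And>x. f x \<le> B"
  shows "integral {0..1} f \<le> B"
  using integral_le[OF integrable_continuous_interval[OF continuous_on_subset[OF assms(1)]]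
      integrable_const_ivl[of B 0 1]] assms(2) by simp

lemma integral_unit_ge:
  fixes f :: "real \<Rightarrow> real"
  assumes "continuous_on UNIV f" "\<And>x. A \<le> f x"
  shows "A \<le> integral {0..1} f"
  using integral_le[OF integrable_const_ivl[of A 0 1]
      integrable_continuous_interval[OF continuous_on_subset[OF assms(1)]]] assms(2) by simp

lemma continuous_on_angular_speed:
  fixes S :: "'a::t2_space set"
  assumes "continuous_on S c" "continuous_on S d" "continuous_on S a" "continuous_on S x"
    "\<And>z. z \<in> S \<Longrightarrow> 0 < profile (a z) b (x z)" "\<And>z. z \<in> S \<Longrightarrow> profile (a z) b (x z) < 1"
  shows "continuous_on S (\<lambda>z. angular_speed (c z) (d z) (a z) b (x z))"
proof -
  have "continuous_on S (\<lambda>z. profile (a z) b (x z))"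
    unfolding profile_def by (intro continuous_intros assms)
  moreover have "sqrt (profile (a z) b (x z)) \<noteq> 0" "1 - profile (a z) b (x z) \<noteq> 0" if "z \<in> S" for z
    using assms(5,6)[OF that] by auto
  ultimately show ?thesis
    unfolding angular_speed_def by (intro continuous_intros assms) auto
qed

text \<open>In the limit \<open>b = 0\<close> the period integral is \<open>2 * sqrt a\<close>, which crosses \<open>1\<close> at \<open>a = 1/4\<close>.\<close>

lemma period_problem:
  obtains a b c d :: real where "0 < b" "b < a" "a < 1 / 2" "a + b < 1" "0 < c" "c < d"
    "c\<^sup>2 = a\<^sup>2 - b\<^sup>2" "d\<^sup>2 = (1 - a)\<^sup>2 - b\<^sup>2" "integral {0..1} (angular_speed c d a b) = 1"
proof -
  \<comment> \<open>Small enough that crude estimates separate the two ends: at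
    \<open>a = 16/100\<close> and \<open>a = 36/100\<close> the limiting values
    \<open>2 * sqrt a\<close> are 4/5 and 6/5.\<close>
  define b :: real where "b = 1 / 100"
  define c where "c a = sqrt (a\<^sup>2 - b\<^sup>2)" for a
  define d where "d a = sqrt ((1 - a)\<^sup>2 - b\<^sup>2)" for a
  define J where "J a = integral {0..1} (angular_speed (c a) (d a) a b)" for a
  have u: "0 < profile a b x" "profile a b x < 1" if "a \<in> {16/100..36/100}" for a x
    using profile_bounds[of b a x] that by (auto simp: b_def)
  have cd: "continuous_on S c" "continuous_on S d" for S
    unfolding c_def d_def by (intro continuous_intros)+
  have "continuous_on ({16/100..36/100} \<times> cbox 0 1) (\<lambda>(a, x). angular_speed (c a) (d a) a b x)"
    unfolding split_beta
    by (intro continuous_on_angular_speed continuous_on_compose2[OF cd(1)[of UNIV]]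
        continuous_on_compose2[OF cd(2)[of UNIV]] continuous_on_fst continuous_on_snd continuous_on_id)
      (use u in auto)
  from integral_continuous_on_param[OF this]
  have J: "continuous_on {16/100..36/100} J" unfolding J_def by (simp add: cbox_interval)
  have cu: "continuous_on UNIV (angular_speed (c a) (d a) a b)" if "a \<in> {16/100..36/100}" for a
    by (intro continuous_on_angular_speed continuous_on_const continuous_on_id u[OF that])
  have cb: "a - b \<le> c a" "c a \<le> a" "1 - a - b \<le> d a" "d a \<le> 1 - a" if "a \<in> {16/100..36/100}" for a
  proof -
    have "(a - b)\<^sup>2 \<le> a\<^sup>2 - b\<^sup>2" "(1 - a - b)\<^sup>2 \<le> (1 - a)\<^sup>2 - b\<^sup>2"
      using that by (auto simp: b_def power2_eq_square algebra_simps)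
    then show "a - b \<le> c a" "c a \<le> a" "1 - a - b \<le> d a" "d a \<le> 1 - a"
      using that by (auto simp: c_def d_def intro!: real_le_rsqrt real_le_lsqrt)
  qed
  \<comment> \<open>The numbers 38/100 and 42/100 enclose the square roots of \<open>a - b\<close>
    and \<open>a + b\<close>; \<open>c\<close> and \<open>d\<close> are replaced by their upper
    bounds \<open>a\<close> and \<open>1 - a\<close>.\<close>
  have "J (16/100) \<le> (16/100) / (38/100) + (84/100) * (42/100) / (1 - (42/100)\<^sup>2)"
    unfolding J_def using cb[of "16/100"]
    by (intro integral_unit_le cu angular_speed_bounds(2)[where ?c0.0=0 and ?d0.0=0])
      (auto simp: b_def power2_eq_square)
  also have "\<dots> \<le> 1" by (simp add: power2_eq_square)
  finally have J1: "J (16/100) \<le> 1" .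
  \<comment> \<open>Now 59/100 and 61/100 enclose the square roots, and \<open>c\<close>,
    \<open>d\<close> are replaced by their lower bounds \<open>a - b\<close> and
    \<open>1 - a - b\<close>.\<close>
  have "1 \<le> (35/100) / (61/100) + (63/100) * (59/100) / (1 - (59/100)\<^sup>2 :: real)"
    by (simp add: power2_eq_square)
  also have "\<dots> \<le> J (36/100)"
    unfolding J_def using cb[of "36/100"]
    by (intro integral_unit_ge cu angular_speed_bounds(1)[where ?c1.0=1 and ?d1.0=1])
      (auto simp: b_def power2_eq_square)
  finally obtain a where a: "16/100 \<le> a" "a \<le> 36/100" "J a = 1"
    using IVT'[of J "16/100" 1 "36/100"] J J1 by auto
  have sq: "b\<^sup>2 < a\<^sup>2" "b\<^sup>2 < (1 - a)\<^sup>2"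
    using a by (auto simp: b_def intro!: power_strict_mono)
  show thesis
  proof (rule that)
    show "(c a)\<^sup>2 = a\<^sup>2 - b\<^sup>2" "(d a)\<^sup>2 = (1 - a)\<^sup>2 - b\<^sup>2"
      using sq by (simp_all add: c_def d_def)
    show "0 < c a" using sq by (simp add: c_def)
    have "a\<^sup>2 < (1 - a)\<^sup>2" using a by (intro power_strict_mono) auto
    then show "c a < d a" by (simp add: c_def d_def)
    show "integral {0..1} (angular_speed (c a) (d a) a b) = 1" using a(3) by (simp add: J_def)
  qed (use a in \<open>auto simp: b_def\<close>)
qed

section \<open>The unduloid torus\<close>

text \<open>Differentiating the vanishing product of \<open>dF\<close> with \<open>\<nu>\<close>
  gives the second fundamental form in direction \<open>\<nu>\<close> as \<open>k i\<close> times
  the metric; the trace follows in orthogonal coordinates.\<close>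

lemma mean_curvature_inner_shape:
  fixes F :: "real ^ 2 \<Rightarrow> 'a::euclidean_space"
  assumes F: "torus_immersion F" and \<nu>: "smooth_on \<nu> UNIV" "\<And>p. \<nu> p \<in> normal_space F p"
    and orth: "metric_coeff F 1 2 p = 0"
    and shape: "\<And>i. dir_deriv \<nu> p (axis i 1) = - k i *\<^sub>R dir_deriv F p (axis i 1)"
  shows "mean_curvature F p \<bullet> \<nu> p = k 1 + k 2"
proof -
  note L = torus_immersionD[OF F]
  have s: "second_deriv F i i p \<bullet> \<nu> p = k i * metric_coeff F i i p" for i
  proof -
    have "(\<lambda>q. dir_deriv F q (axis i 1) \<bullet> \<nu> q) = (\<lambda>q. 0)"
      using \<nu>(2) by (auto simp: normal_space_iff)
    then show ?thesis
      using dir_deriv_inner[OF smooth_on_dir_deriv[OF L(1), of "axis i 1"] \<nu>(1), of p "axis i 1"]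
      by (simp add: dir_deriv_const second_deriv_def shape metric_coeff_def)
  qed
  have "metric_det F p * (mean_curvature F p \<bullet> \<nu> p) = metric_det F p * (k 1 + k 2)"
    using mean_curvature_inner(2)[OF L(2,3) \<nu>(2)[of p]]
    by (simp add: s orth metric_det_def algebra_simps)
  then show ?thesis using metric_det_pos(2)[OF L(2,3), of p] by simp
qed

text \<open>The quotient property is compactness: the complement of a set with open preimage is the
  image of a closed subset of the unit cube, hence compact, because the cube meets every lattice
  class.\<close>

lemma torus_embeddingI:
  fixes F :: "real ^ 'm \<Rightarrow> 'a::euclidean_space"
  assumes F: "torus_immersion F" and inj: "\<And>p q. F p = F q \<Longrightarrow> p - q \<in> int_lattice"
  shows "torus_embedding F"
proof -
  have per: "torus_periodic F" and cont: "continuous_on UNIV F"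
    using F smooth_on_imp_continuous by (auto simp: torus_immersion_def)
  have "quotient_map euclidean (top_of_set (range F)) F"
    unfolding quotient_map_def
  proof (intro conjI allI impI)
    show "F ` topspace euclidean = topspace (top_of_set (range F))" by simp
    fix U assume U: "U \<subseteq> topspace (top_of_set (range F))"
    let ?P = "{x \<in> topspace euclidean. F x \<in> U}"
    show "openin euclidean ?P = openin (top_of_set (range F)) U"
    proof
      assume "openin (top_of_set (range F)) U"
      then show "openin euclidean ?P"
        using continuous_openin_preimage[OF cont, of "range F" U] by (simp add: vimage_def)
    next
      assume "openin euclidean ?P"
      then have "closed (- ?P)" by (simp add: closed_def)
      then have "compact (cbox 0 (vec 1) \<inter> - ?P)" by (simp add: compact_Int_closed)
      then have "compact (F ` (cbox 0 (vec 1) \<inter> - ?P))"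
        using compact_continuous_image continuous_on_subset[OF cont] by blast
      moreover have "F ` (cbox 0 (vec 1) \<inter> - ?P) = range F - U"
      proof (intro equalityI subsetI)
        fix y assume "y \<in> range F - U"
        then obtain x where x: "y = F x" "F x \<notin> U" by auto
        obtain q where "q \<in> cbox 0 (vec 1)" "\<And>f :: real ^ 'm \<Rightarrow> 'a. torus_periodic f \<Longrightarrow> f x = f q"
          using torus_periodic_reduce[of x] by blast
        then have "q \<in> cbox 0 (vec 1)" "F x = F q" using per by blast+
        then show "y \<in> F ` (cbox 0 (vec 1) \<inter> - ?P)" using x by auto
      qed auto
      ultimately have "closed (range F - U)" using compact_imp_closed by metis
      then have "openin (top_of_set (range F)) (range F - (range F - U))"
        by (intro openin_diff openin_subtopology_self) (auto simp: closedin_closed)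
      moreover have "range F - (range F - U) = U" using U by auto
      ultimately show "openin (top_of_set (range F)) U" by simp
    qed
  qed
  then show ?thesis using F inj by (auto simp: torus_embedding_def)
qed

text \<open>The angle and its closing condition are assumptions, which separates the geometry from
  the period problem. The equations for \<open>c\<close> and \<open>d\<close> make
  \<open>w^2 + S^2\<close>, as a polynomial in \<open>u\<close>, vanish at \<open>u = 0\<close> and
  \<open>u = 1\<close>.\<close>

locale unduloid =
  fixes a b c d :: real and \<phi> :: "real \<Rightarrow> real"
  assumes b: "0 < b" "b < a" and a: "a < 1 / 2" "a + b < 1" and cd: "0 < c" "c < d"
    and c2: "c\<^sup>2 = a\<^sup>2 - b\<^sup>2" and d2: "d\<^sup>2 = (1 - a)\<^sup>2 - b\<^sup>2"
    and \<phi>_deriv: "(\<phi> has_real_derivative 2 * pi * angular_speed c d a b x) (at x)"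
    and \<phi>_shift: "\<phi> (x + 1) = \<phi> x + 2 * pi"
begin

definition "u = profile a b"
definition "S x = b * sin (4 * pi * x)"
definition "r x = sqrt (u x)"
definition "q x = sqrt (1 - u x)"
text \<open>\<open>\<sigma>\<close> is the slope of \<open>w\<close> as a function of
  \<open>u\<close>. The profile curve has constant speed \<open>2 * pi / \<omega>\<close>, so the
  parameter \<open>x\<close> is proportional to arc length.\<close>

definition "\<sigma> = d - c"
definition "\<omega> = 1 / sqrt (1 - \<sigma>\<^sup>2)"
definition "w x = c + \<sigma> * u x"
definition "\<phi>' x = 2 * pi * w x / (r x * (q x)\<^sup>2)"

text \<open>The principal curvatures \<open>\<kappa> 1\<close> and \<open>\<kappa> 2\<close> of the torus in the unit 3-sphere have the constant
  sum \<open>2 * \<omega> * \<sigma>\<close>.\<close>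

definition \<kappa> :: "2 \<Rightarrow> real \<Rightarrow> real" where
  "\<kappa> i x = \<omega> * (if i = 1 then \<sigma> - c / u x else \<sigma> + c / u x)"

lemma u_bounds: "0 < u x" "u x < 1"
  using profile_bounds[of b a x] a b by (auto simp: u_def)

lemma rq_pos: "0 < r x" "0 < q x" and rq_sq: "(r x)\<^sup>2 = u x" "(q x)\<^sup>2 = 1 - u x"
  using u_bounds[of x] by (auto simp: r_def q_def)

lemma rq_ne [simp]: "r x \<noteq> 0" "q x \<noteq> 0" "u x \<noteq> 0"
  using rq_pos[of x] u_bounds[of x] by auto

text \<open>Positivity makes the mean curvature \<open>2 * \<omega> * \<sigma>\<close> within the
  sphere nonzero; the upper bound makes \<open>\<omega>\<close> meaningful.\<close>

lemma \<sigma>_bounds: "0 < \<sigma>" "\<sigma> < 1"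
proof -
  have "d\<^sup>2 < (1 - a)\<^sup>2" using d2 b by simp
  then have "d < 1 - a" by (rule power_less_imp_less_base) (use a in simp)
  then show "0 < \<sigma>" "\<sigma> < 1" using cd b by (auto simp: \<sigma>_def)
qed

lemma \<omega>: "0 < \<omega>" "\<omega>\<^sup>2 * (1 - \<sigma>\<^sup>2) = 1"
proof -
  have "\<sigma>\<^sup>2 < 1" using \<sigma>_bounds by (simp add: power_less_one_iff abs_square_less_1)
  then show "0 < \<omega>" "\<omega>\<^sup>2 * (1 - \<sigma>\<^sup>2) = 1" by (auto simp: \<omega>_def power_divide)
qed

lemma \<sigma>_quadratic: "\<sigma>\<^sup>2 + 2 * c * \<sigma> + 2 * a = 1"
  using c2 d2 by (simp add: \<sigma>_def power2_eq_square algebra_simps)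

lemma S_sq: "(S x)\<^sup>2 = b\<^sup>2 - (u x - a)\<^sup>2"
proof -
  have "(S x)\<^sup>2 + (u x - a)\<^sup>2 = b\<^sup>2 * ((sin (4 * pi * x))\<^sup>2 + (cos (4 * pi * x))\<^sup>2)"
    unfolding S_def u_def profile_def distrib_left by (simp add: power_mult_distrib)
  then show ?thesis by simp
qed

text \<open>The first integral of the equation of constant mean curvature, which determines the profile.\<close>

lemma first_integral: "(w x)\<^sup>2 + (S x)\<^sup>2 = (1 - \<sigma>\<^sup>2) * (u x * (1 - u x))"
  using \<sigma>_quadratic c2 unfolding S_sq w_def by algebra

text \<open>\<open>w\<close> interpolates linearly between \<open>c\<close> at \<open>u = 0\<close>
  and \<open>d\<close> at \<open>u = 1\<close>, so it equals \<open>c * q^2 + d * r^2\<close>. The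
  form \<open>\<phi>'\<close> is the one forced by orthogonality of the normal to the profile
  curve.\<close>

lemma \<phi>'_eq: "2 * pi * angular_speed c d a b x = \<phi>' x"
proof -
  have "angular_speed c d a b x = c / r x + d * r x / (q x)\<^sup>2"
    unfolding angular_speed_def rq_sq by (simp add: u_def r_def)
  also have "\<dots> = (c * (q x)\<^sup>2 + d * (r x)\<^sup>2) / (r x * (q x)\<^sup>2)"
    by (simp add: field_simps power2_eq_square)
  also have "c * (q x)\<^sup>2 + d * (r x)\<^sup>2 = w x"
    unfolding rq_sq by (simp add: w_def \<sigma>_def algebra_simps)
  finally show ?thesis by (simp add: \<phi>'_def)
qed

lemma deriv_\<phi>: "(\<phi> has_real_derivative \<phi>' x) (at x)"
  using \<phi>_deriv by (simp add: \<phi>'_eq)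

lemma deriv_u: "(u has_real_derivative - 4 * pi * S x) (at x)"
  unfolding u_def profile_def[abs_def] S_def by (auto intro!: derivative_eq_intros)

lemma deriv_S: "(S has_real_derivative 4 * pi * (u x - a)) (at x)"
  unfolding u_def profile_def S_def[abs_def] by (auto intro!: derivative_eq_intros)

lemma deriv_r: "(r has_real_derivative - 2 * pi * S x / r x) (at x)"
  unfolding r_def[abs_def] using u_bounds[of x]
  by (auto intro!: derivative_eq_intros deriv_u simp: field_simps)

lemma deriv_q: "(q has_real_derivative 2 * pi * S x / q x) (at x)"
  unfolding q_def[abs_def] using u_bounds[of x]
  by (auto intro!: derivative_eq_intros deriv_u simp: field_simps)

lemma deriv_w: "(w has_real_derivative - 4 * pi * \<sigma> * S x) (at x)"
  unfolding w_def[abs_def] by (auto intro!: derivative_eq_intros deriv_u)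

section \<open>Coefficients of the unit normal within the 3-sphere\<close>

text \<open>The normal has radial coefficients \<open>\<alpha>\<close> and \<open>\<beta>\<close> in
  the two coordinate planes and coefficient \<open>- \<gamma>\<close> along the rotation of the
  second. The constant curvature sum makes \<open>r * \<alpha>\<close> an affine function of
  \<open>u\<close>; orthogonality to the position vector then gives \<open>\<beta>\<close>, and unit
  length gives \<open>\<gamma>\<close> up to sign.\<close>

definition "\<alpha> x = - (\<omega> * w x / r x)"
definition "\<beta> x = \<omega> * w x / q x"
definition "\<gamma> x = \<omega> * S x / (r x * q x)"

text \<open>This lemma and the next two are the components of the Weingarten equation along the
  profile, where the derivative of the normal is \<open>- \<kappa> 1\<close> times that of the
  position.\<close>

lemma deriv_\<alpha>: "(\<alpha> has_real_derivative - \<kappa> 1 x * (- 2 * pi * S x / r x)) (at x)"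
proof -
  define R W where RW: "R = r x" "W = w x"
  have W: "W = c + \<sigma> * R\<^sup>2" and R: "R \<noteq> 0" and u: "u x = R\<^sup>2" by (auto simp: RW w_def rq_sq)
  have "(\<alpha> has_real_derivative - ((\<omega> * (- 4 * pi * \<sigma> * S x) * R - \<omega> * W * (- 2 * pi * S x / R)) / (R * R))) (at x)"
    unfolding \<alpha>_def[abs_def] RW by (intro DERIV_minus DERIV_divide DERIV_cmult deriv_w deriv_r rq_ne)
  moreover have "- ((\<omega> * (- 4 * pi * \<sigma> * S x) * R - \<omega> * W * (- 2 * pi * S x / R)) / (R * R)) =
      - (\<omega> * (\<sigma> - c / R\<^sup>2)) * (- 2 * pi * S x / R)"
    using R by (simp add: W field_simps power2_eq_square)
  ultimately show ?thesis by (simp add: \<kappa>_def u RW(1))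
qed

lemma deriv_\<beta>: "(\<beta> has_real_derivative - \<kappa> 1 x * (2 * pi * S x / q x) - \<gamma> x * \<phi>' x) (at x)"
proof -
  define R Q W where RW: "R = r x" "Q = q x" "W = w x"
  have W: "W = c + \<sigma> * R\<^sup>2" and R: "R \<noteq> 0" "Q \<noteq> 0" and u: "u x = R\<^sup>2" and Q: "Q\<^sup>2 + R\<^sup>2 = 1"
    by (auto simp: RW w_def rq_sq)
  have "(\<beta> has_real_derivative (\<omega> * (- 4 * pi * \<sigma> * S x) * Q - \<omega> * W * (2 * pi * S x / Q)) / (Q * Q)) (at x)"
    unfolding \<beta>_def[abs_def] RW by (intro DERIV_divide DERIV_cmult deriv_w deriv_q rq_ne)
  moreover have "(\<omega> * (- 4 * pi * \<sigma> * S x) * Q - \<omega> * W * (2 * pi * S x / Q)) / (Q * Q) =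
      - (\<omega> * (\<sigma> - c / R\<^sup>2)) * (2 * pi * S x / Q) - \<omega> * S x / (R * Q) * (2 * pi * W / (R * Q\<^sup>2))"
    (is "?A = ?B")
  proof -
    have A: "?A = 2 * pi * \<omega> * S x * ((- 2 * \<sigma> * Q\<^sup>2 - W) * R\<^sup>2) / (Q ^ 3 * R\<^sup>2)"
      using R by (simp add: field_simps power2_eq_square power3_eq_cube)
    have B: "?B = 2 * pi * \<omega> * S x * (- (\<sigma> * R\<^sup>2 - c) * Q\<^sup>2 - W) / (Q ^ 3 * R\<^sup>2)"
      using R by (simp add: field_simps power2_eq_square power3_eq_cube)
    have "(- 2 * \<sigma> * Q\<^sup>2 - W) * R\<^sup>2 = - (\<sigma> * R\<^sup>2 - c) * Q\<^sup>2 - W"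
      using W Q by algebra
    then show ?thesis unfolding A B by (rule arg_cong)
  qed
  ultimately show ?thesis by (simp add: \<kappa>_def \<gamma>_def \<phi>'_def u mult.assoc flip: RW)
qed

lemma deriv_\<gamma>: "(\<gamma> has_real_derivative \<kappa> 1 x * (q x * \<phi>' x) + \<beta> x * \<phi>' x) (at x)"
proof -
  define R Q W where RW: "R = r x" "Q = q x" "W = w x"
  have W: "W = c + \<sigma> * R\<^sup>2" and R: "R \<noteq> 0" "Q \<noteq> 0" and u: "u x = R\<^sup>2" and Q: "Q\<^sup>2 + R\<^sup>2 = 1"
    by (auto simp: RW w_def rq_sq)
  have S: "W\<^sup>2 + (S x)\<^sup>2 = (1 - \<sigma>\<^sup>2) * (R\<^sup>2 * Q\<^sup>2)"
    using first_integral[of x] by (simp add: RW rq_sq)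
  have "(\<gamma> has_real_derivative (\<omega> * (4 * pi * (R\<^sup>2 - a)) * (R * Q) - \<omega> * S x *
      (- 2 * pi * S x / R * Q + 2 * pi * S x / Q * R)) / (R * Q * (R * Q))) (at x)"
    unfolding \<gamma>_def[abs_def] RW rq_sq
    by (intro DERIV_divide DERIV_mult DERIV_cmult deriv_S deriv_r deriv_q) simp
  moreover have "(\<omega> * (4 * pi * (R\<^sup>2 - a)) * (R * Q) - \<omega> * S x *
      (- 2 * pi * S x / R * Q + 2 * pi * S x / Q * R)) / (R * Q * (R * Q)) =
      2 * pi * \<omega> * (2 * (R\<^sup>2 - a) * R\<^sup>2 * Q\<^sup>2 + (S x)\<^sup>2 * (Q\<^sup>2 - R\<^sup>2)) / (R ^ 3 * Q ^ 3)"
    using R by (simp add: field_simps power2_eq_square power3_eq_cube)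
  moreover have "\<omega> * (\<sigma> - c / R\<^sup>2) * (Q * (2 * pi * W / (R * Q\<^sup>2))) + \<omega> * W / Q * (2 * pi * W / (R * Q\<^sup>2)) =
      2 * pi * \<omega> * (W * ((\<sigma> * R\<^sup>2 - c) * Q\<^sup>2 + W * R\<^sup>2)) / (R ^ 3 * Q ^ 3)"
    using R by (simp add: field_simps power2_eq_square power3_eq_cube)
  \<comment> \<open>Unlike the other two components, the rotational one rests on the first integral
    and on the relation \<open>\<sigma>_quadratic\<close>.\<close>
  moreover have "2 * (R\<^sup>2 - a) * R\<^sup>2 * Q\<^sup>2 + (S x)\<^sup>2 * (Q\<^sup>2 - R\<^sup>2) = W * ((\<sigma> * R\<^sup>2 - c) * Q\<^sup>2 + W * R\<^sup>2)"
    using W Q S \<sigma>_quadratic by algebra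
  ultimately show ?thesis by (simp add: \<kappa>_def \<beta>_def \<phi>'_def u flip: RW)
qed

section \<open>The embedding and its normal field\<close>

definition F :: "real ^ 2 \<Rightarrow> real ^ 4" where
  "F p = vector [r (p$1) * cos (2 * pi * p$2), r (p$1) * sin (2 * pi * p$2),
     q (p$1) * cos (\<phi> (p$1)), q (p$1) * sin (\<phi> (p$1))]"

definition F1 :: "real ^ 2 \<Rightarrow> real ^ 4" where
  "F1 p = (let x = p$1; y = 2 * pi * p$2; r' = - 2 * pi * S x / r x; q' = 2 * pi * S x / q x in
    vector [r' * cos y, r' * sin y, q' * cos (\<phi> x) - q x * \<phi>' x * sin (\<phi> x),
      q' * sin (\<phi> x) + q x * \<phi>' x * cos (\<phi> x)])"

definition F2 :: "real ^ 2 \<Rightarrow> real ^ 4" where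
  "F2 p = (let x = p$1; y = 2 * pi * p$2 in
    vector [- 2 * pi * r x * sin y, 2 * pi * r x * cos y, 0, 0])"

definition \<nu> :: "real ^ 2 \<Rightarrow> real ^ 4" where
  "\<nu> p = vector [\<alpha> (p$1) * cos (2 * pi * p$2), \<alpha> (p$1) * sin (2 * pi * p$2),
     \<beta> (p$1) * cos (\<phi> (p$1)) + \<gamma> (p$1) * sin (\<phi> (p$1)),
     \<beta> (p$1) * sin (\<phi> (p$1)) - \<gamma> (p$1) * cos (\<phi> (p$1))]"

lemma has_derivative_first_coord:
  assumes "(f has_real_derivative f') (at (p$1))"
  shows "((\<lambda>p :: real ^ 2. f (p$1)) has_derivative (\<lambda>v. v$1 * f')) (at p)"
  by (rule DERIV_compose_FDERIV[OF assms bounded_linear_imp_has_derivative[OF bounded_linear_vec_nth]])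

lemma has_derivative_second_coord: "((\<lambda>p :: real ^ 2. p$2) has_derivative (\<lambda>v. v$2)) (at p)"
  by (rule bounded_linear_imp_has_derivative[OF bounded_linear_vec_nth])

lemmas coord_derivs =
  has_derivative_first_coord[OF deriv_r] has_derivative_first_coord[OF deriv_q]
  has_derivative_first_coord[OF deriv_\<phi>] has_derivative_first_coord[OF deriv_\<alpha>]
  has_derivative_first_coord[OF deriv_\<beta>] has_derivative_first_coord[OF deriv_\<gamma>]
  has_derivative_second_coord

lemma F_has_derivative: "(F has_derivative (\<lambda>v. v$1 *\<^sub>R F1 p + v$2 *\<^sub>R F2 p)) (at p)"
proof (rule has_derivative_vec)
  fix i :: 4
  show "((\<lambda>p. F p $ i) has_derivative (\<lambda>v. (v$1 *\<^sub>R F1 p + v$2 *\<^sub>R F2 p) $ i)) (at p)"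
    using exhaust_4[of i]
    by (elim disjE; simp only: F_def F1_def F2_def Let_def vector_4_nth vector_add_component vector_scaleR_component)
      (auto intro!: derivative_eq_intros coord_derivs simp: algebra_simps)
qed

text \<open>The Weingarten equation along the circles of rotation: there the normal turns with
  radius \<open>\<alpha>\<close> and the position with radius \<open>r\<close>.\<close>

lemma \<kappa>2: "\<kappa> 2 x * r x = - \<alpha> x"
  using rq_sq(1)[of x] by (simp add: \<kappa>_def \<alpha>_def w_def field_simps power2_eq_square)

lemma \<nu>_has_derivative:
  "(\<nu> has_derivative (\<lambda>v. v$1 *\<^sub>R (- \<kappa> 1 (p$1) *\<^sub>R F1 p) + v$2 *\<^sub>R (- \<kappa> 2 (p$1) *\<^sub>R F2 p))) (at p)"
proof (rule has_derivative_vec)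
  fix i :: 4
  have \<alpha>: "\<alpha> (p$1) = - \<kappa> 2 (p$1) * r (p$1)" using \<kappa>2 by simp
  show "((\<lambda>p. \<nu> p $ i) has_derivative
     (\<lambda>v. (v$1 *\<^sub>R (- \<kappa> 1 (p$1) *\<^sub>R F1 p) + v$2 *\<^sub>R (- \<kappa> 2 (p$1) *\<^sub>R F2 p)) $ i)) (at p)"
    using exhaust_4[of i]
    by (elim disjE; simp only: \<nu>_def F1_def F2_def Let_def vector_4_nth vector_add_component vector_scaleR_component)
      (auto intro!: derivative_eq_intros coord_derivs simp: algebra_simps \<alpha>)
qed

lemma smooth_profile:
  shows "Ck_on k (\<lambda>p :: real ^ 2. u (p$1)) UNIV" "Ck_on k (\<lambda>p :: real ^ 2. S (p$1)) UNIV"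
    "Ck_on k (\<lambda>p :: real ^ 2. inverse (r (p$1))) UNIV" "Ck_on k (\<lambda>p :: real ^ 2. inverse (q (p$1))) UNIV"
    "Ck_on k (\<lambda>p :: real ^ 2. r (p$1)) UNIV" "Ck_on k (\<lambda>p :: real ^ 2. q (p$1)) UNIV"
    "Ck_on k (\<lambda>p :: real ^ 2. w (p$1)) UNIV" "Ck_on k (\<lambda>p :: real ^ 2. \<phi> (p$1)) UNIV"
proof -
  have x: "Ck_on k (\<lambda>p :: real ^ 2. 4 * pi * p$1) UNIV" for k
    by (intro Ck_on_mult Ck_on_const Ck_on_bounded_linear bounded_linear_vec_nth)
  show u: "Ck_on k (\<lambda>p :: real ^ 2. u (p$1)) UNIV" for k
    unfolding u_def profile_def using Ck_on_sin_cos[OF x] by (intro Ck_on_add Ck_on_mult Ck_on_const) auto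
  show S: "Ck_on k (\<lambda>p :: real ^ 2. S (p$1)) UNIV" for k
    unfolding S_def using Ck_on_sin_cos[OF x] by (intro Ck_on_mult Ck_on_const) auto
  show r: "Ck_on k (\<lambda>p :: real ^ 2. r (p$1)) UNIV" for k
    unfolding r_def by (intro Ck_on_sqrt u u_bounds)
  show q: "Ck_on k (\<lambda>p :: real ^ 2. q (p$1)) UNIV" for k
    unfolding q_def using u_bounds by (intro Ck_on_sqrt Ck_on_diff Ck_on_const u) auto
  show ir: "Ck_on k (\<lambda>p :: real ^ 2. inverse (r (p$1))) UNIV"
    and iq: "Ck_on k (\<lambda>p :: real ^ 2. inverse (q (p$1))) UNIV" for k
    by (intro Ck_on_inverse rq_ne r q)+
  show w: "Ck_on k (\<lambda>p :: real ^ 2. w (p$1)) UNIV" for k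
    unfolding w_def by (intro Ck_on_add Ck_on_mult Ck_on_const u)
  have "Ck_on k (\<lambda>p :: real ^ 2. \<phi>' (p$1)) UNIV" for k
    unfolding \<phi>'_def divide_inverse power2_eq_square inverse_mult_distrib
    by (intro Ck_on_mult Ck_on_const w ir iq)
  \<comment> \<open>The angle is known only as an antiderivative; its derivative is explicit and
    smooth, so it gains one order.\<close>
  then have "Ck_on (Suc k) (\<lambda>p :: real ^ 2. \<phi> (p$1)) UNIV" for k
    by (intro Ck_on_SucI[OF has_derivative_first_coord[OF deriv_\<phi>]] Ck_on_mult Ck_on_const)
  then show "Ck_on k (\<lambda>p :: real ^ 2. \<phi> (p$1)) UNIV" by (rule Ck_on_Suc_imp)
qed

lemma smooth_angle: "Ck_on k (\<lambda>p :: real ^ 2. 2 * pi * p$2) UNIV"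
  by (intro Ck_on_mult Ck_on_const Ck_on_bounded_linear bounded_linear_vec_nth)

lemmas smooth_trig = Ck_on_sin_cos[OF smooth_angle, THEN conjunct1] Ck_on_sin_cos[OF smooth_angle, THEN conjunct2]
  Ck_on_sin_cos[OF smooth_profile(8), THEN conjunct1] Ck_on_sin_cos[OF smooth_profile(8), THEN conjunct2]

lemma smooth_F: "smooth_on F UNIV"
proof (rule smooth_on_vec)
  fix i :: 4
  show "smooth_on (\<lambda>p. F p $ i) UNIV"
    using exhaust_4[of i] unfolding smooth_on_def
    by (elim disjE; simp only: F_def vector_4_nth) (intro allI Ck_on_mult smooth_trig smooth_profile)+
qed

lemma smooth_\<nu>: "smooth_on \<nu> UNIV"
proof (rule smooth_on_vec)
  fix i :: 4
  show "smooth_on (\<lambda>p. \<nu> p $ i) UNIV"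
    using exhaust_4[of i] unfolding smooth_on_def
    by (elim disjE; simp only: \<nu>_def vector_4_nth \<alpha>_def \<beta>_def \<gamma>_def divide_inverse inverse_mult_distrib)
      (intro allI Ck_on_add Ck_on_diff Ck_on_mult Ck_on_minus Ck_on_const smooth_trig smooth_profile)+
qed

lemma dir_deriv_F: "dir_deriv F p v = v$1 *\<^sub>R F1 p + v$2 *\<^sub>R F2 p"
  by (rule dir_deriv_eq[OF F_has_derivative])

lemma axis_2_nth [simp]: "axis (1::2) (1::real) $ 1 = 1" "axis (1::2) (1::real) $ 2 = 0"
  "axis (2::2) (1::real) $ 1 = 0" "axis (2::2) (1::real) $ 2 = 1"
  by (simp_all add: axis_def)

lemma dir_deriv_\<nu>: "dir_deriv \<nu> p (axis i 1) = - \<kappa> i (p$1) *\<^sub>R dir_deriv F p (axis i 1)"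
  using exhaust_2[of i] by (auto simp: dir_deriv_eq[OF \<nu>_has_derivative] dir_deriv_F)

lemma \<phi>'_pos: "0 < \<phi>' x"
  using rq_pos[of x] u_bounds[of x] cd \<sigma>_bounds by (simp add: \<phi>'_def w_def add_pos_pos)

lemma F1_F2: "F1 p \<bullet> F2 p = 0"
  by (simp add: inner_real4 F1_def F2_def Let_def)

text \<open>The component of \<open>F1\<close> along the rotation in the second plane is
  \<open>q * \<phi>'\<close>, which is positive.\<close>

lemma F1_ne_0: "F1 p \<noteq> 0"
proof
  assume "F1 p = 0"
  then have "F1 p $ 3 = 0" "F1 p $ 4 = 0" by simp_all
  then have "F1 p $ 4 * cos (\<phi> (p$1)) - F1 p $ 3 * sin (\<phi> (p$1)) = 0" by simp
  moreover have "F1 p $ 4 * cos (\<phi> (p$1)) - F1 p $ 3 * sin (\<phi> (p$1)) =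
      q (p$1) * \<phi>' (p$1) * ((sin (\<phi> (p$1)))\<^sup>2 + (cos (\<phi> (p$1)))\<^sup>2)"
    unfolding distrib_left by (simp add: F1_def Let_def algebra_simps power2_eq_square)
  ultimately show False using \<phi>'_pos[of "p$1"] by simp
qed

lemma F2_ne_0: "F2 p \<noteq> 0"
proof
  assume "F2 p = 0"
  then have "F2 p $ 1 = 0" "F2 p $ 2 = 0" by simp_all
  then have "sin (2 * pi * p$2) = 0" "cos (2 * pi * p$2) = 0" by (simp_all add: F2_def Let_def)
  then show False using sin_cos_squared_add[of "2 * pi * p$2"] by simp
qed

lemma \<phi>_shift_int: "\<phi> (x + of_int n) = \<phi> x + 2 * pi * of_int n"
proof -
  have nat: "\<phi> (x + of_nat n) = \<phi> x + 2 * pi * of_nat n" for x and n :: nat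
  proof (induction n)
    case (Suc n)
    then show ?case using \<phi>_shift[of "x + of_nat n"] by (simp add: algebra_simps)
  qed simp
  show ?thesis
  proof (cases "0 \<le> n")
    case True
    then show ?thesis using nat[of x "nat n"] by simp
  next
    case False
    then show ?thesis using nat[of "x + of_int n" "nat (- n)"] by (simp add: algebra_simps)
  qed
qed

lemma periodic_F: "torus_periodic F"
  unfolding torus_periodic_def
proof (intro allI ballI)
  fix p k :: "real ^ 2" assume "k \<in> int_lattice"
  then have "k $ 1 \<in> \<int>" "k $ 2 \<in> \<int>" by (simp_all add: int_lattice_def)
  then obtain m n :: int where k: "k $ 1 = of_int m" "k $ 2 = of_int n"
    by (auto elim!: Ints_cases)
  have "cos (4 * pi * (p$1 + of_int m)) = cos (4 * pi * p$1)"
    using sin_cos_eq_iff[of "4 * pi * (p$1 + of_int m)" "4 * pi * p$1"]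
    by (auto simp: algebra_simps intro!: exI[of _ "2 * m"])
  then have u: "u (p$1 + of_int m) = u (p$1)" by (simp add: u_def profile_def)
  have "sin (2 * pi * (p$2 + of_int n)) = sin (2 * pi * p$2) \<and> cos (2 * pi * (p$2 + of_int n)) = cos (2 * pi * p$2)"
    unfolding sin_cos_eq_iff by (rule exI[of _ n]) (simp add: algebra_simps)
  moreover have "sin (\<phi> (p$1 + of_int m)) = sin (\<phi> (p$1)) \<and> cos (\<phi> (p$1 + of_int m)) = cos (\<phi> (p$1))"
    unfolding sin_cos_eq_iff by (rule exI[of _ m]) (simp add: \<phi>_shift_int)
  ultimately show "F (p + k) = F p" by (simp add: F_def r_def q_def k u)
qed

lemma immersion_F: "torus_immersion F"
proof -
  have "v = 0" if "dir_deriv F p v = 0" for p v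
  proof -
    have "v$1 * (F1 p \<bullet> F1 p) = dir_deriv F p v \<bullet> F1 p" "v$2 * (F2 p \<bullet> F2 p) = dir_deriv F p v \<bullet> F2 p"
      by (simp_all add: dir_deriv_F inner_add_left F1_F2 inner_commute[of "F2 p" "F1 p"])
    then have "v$1 = 0" "v$2 = 0" using that F1_ne_0 F2_ne_0 by simp_all
    then show ?thesis by (simp add: vec_eq_iff forall_2)
  qed
  then have "inj (dir_deriv F p)" for p
    using linear_injective_0[OF linear_dir_deriv[OF smooth_F]] by blast
  then show ?thesis using smooth_F periodic_F by (simp add: torus_immersion_def)
qed

lemma polar_inj:
  fixes s t :: real
  assumes "0 < s" "0 < t" "s * cos x = t * cos y" "s * sin x = t * sin y"
  obtains n :: int where "x = y + 2 * pi * of_int n"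
proof -
  have "s\<^sup>2 * ((sin x)\<^sup>2 + (cos x)\<^sup>2) = t\<^sup>2 * ((sin y)\<^sup>2 + (cos y)\<^sup>2)"
    using assms(3,4) unfolding distrib_left power_mult_distrib[symmetric] by simp
  then have "s = t" using assms(1,2) by simp
  then have "sin x = sin y \<and> cos x = cos y" using assms by simp
  then show thesis using that unfolding sin_cos_eq_iff by blast
qed

text \<open>Although \<open>u\<close> takes each value repeatedly, the second angle separates
  points: \<open>\<phi>\<close> is strictly increasing and gains exactly \<open>2 * pi\<close> per
  unit, so it determines the first coordinate modulo integers.\<close>

lemma embedding_F: "torus_embedding F"
proof (rule torus_embeddingI[OF immersion_F])
  fix p q' :: "real ^ 2" assume eq: "F p = F q'"
  have "r (p$1) * cos (2 * pi * p$2) = r (q'$1) * cos (2 * pi * q'$2)"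
    "r (p$1) * sin (2 * pi * p$2) = r (q'$1) * sin (2 * pi * q'$2)"
    "q (p$1) * cos (\<phi> (p$1)) = q (q'$1) * cos (\<phi> (q'$1))"
    "q (p$1) * sin (\<phi> (p$1)) = q (q'$1) * sin (\<phi> (q'$1))"
    using arg_cong[OF eq, of "\<lambda>z. z$1"] arg_cong[OF eq, of "\<lambda>z. z$2"]
      arg_cong[OF eq, of "\<lambda>z. z$3"] arg_cong[OF eq, of "\<lambda>z. z$4"] by (simp_all add: F_def)
  then obtain m n :: int where mn: "2 * pi * p$2 = 2 * pi * q'$2 + 2 * pi * of_int n"
      "\<phi> (p$1) = \<phi> (q'$1) + 2 * pi * of_int m"
    using polar_inj rq_pos by metis
  have "strict_mono \<phi>"
    by (rule strict_monoI) (use DERIV_pos_imp_increasing deriv_\<phi> \<phi>'_pos in blast)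
  moreover have "\<phi> (p$1) = \<phi> (q'$1 + of_int m)" using mn(2) by (simp add: \<phi>_shift_int)
  ultimately have "p$1 = q'$1 + of_int m" using strict_mono_eq by blast
  moreover have "2 * pi * p$2 = 2 * pi * (q'$2 + of_int n)" using mn(1) by (simp add: algebra_simps)
  then have "p$2 = q'$2 + of_int n" by simp
  ultimately show "p - q' \<in> int_lattice" by (simp add: int_lattice_def forall_2)
qed

section \<open>Extrinsic geometry of the torus\<close>

lemma F_F: "F p \<bullet> F p = 1"
proof -
  have "F p \<bullet> F p = (r (p$1))\<^sup>2 * ((sin (2 * pi * p$2))\<^sup>2 + (cos (2 * pi * p$2))\<^sup>2)
      + (q (p$1))\<^sup>2 * ((sin (\<phi> (p$1)))\<^sup>2 + (cos (\<phi> (p$1)))\<^sup>2)"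
    unfolding distrib_left by (simp add: F_def inner_real4 power2_eq_square algebra_simps)
  then show ?thesis by (simp add: rq_sq)
qed

lemma F_\<nu>: "F p \<bullet> \<nu> p = 0"
proof -
  have "F p \<bullet> \<nu> p = r (p$1) * \<alpha> (p$1) * ((sin (2 * pi * p$2))\<^sup>2 + (cos (2 * pi * p$2))\<^sup>2)
      + q (p$1) * \<beta> (p$1) * ((sin (\<phi> (p$1)))\<^sup>2 + (cos (\<phi> (p$1)))\<^sup>2)"
    unfolding distrib_left by (simp add: F_def \<nu>_def inner_real4 power2_eq_square algebra_simps)
  then show ?thesis by (simp add: \<alpha>_def \<beta>_def)
qed

lemma \<nu>_\<nu>: "\<nu> p \<bullet> \<nu> p = 1"
proof -
  define x where "x = p$1"
  have "\<nu> p \<bullet> \<nu> p = (\<alpha> x)\<^sup>2 * ((sin (2 * pi * p$2))\<^sup>2 + (cos (2 * pi * p$2))\<^sup>2)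
      + ((\<beta> x)\<^sup>2 + (\<gamma> x)\<^sup>2) * ((sin (\<phi> x))\<^sup>2 + (cos (\<phi> x))\<^sup>2)"
    unfolding distrib_left by (simp add: \<nu>_def x_def inner_real4 power2_eq_square algebra_simps)
  also have "\<dots> = (\<alpha> x)\<^sup>2 + (\<beta> x)\<^sup>2 + (\<gamma> x)\<^sup>2" by simp
  also have "\<dots> = \<omega>\<^sup>2 * ((w x)\<^sup>2 * ((r x)\<^sup>2 + (q x)\<^sup>2) + (S x)\<^sup>2) / ((r x)\<^sup>2 * (q x)\<^sup>2)"
    by (simp add: \<alpha>_def \<beta>_def \<gamma>_def field_simps power2_eq_square)
  also have "(w x)\<^sup>2 * ((r x)\<^sup>2 + (q x)\<^sup>2) + (S x)\<^sup>2 = (1 - \<sigma>\<^sup>2) * ((r x)\<^sup>2 * (q x)\<^sup>2)"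
    using first_integral[of x] by (simp add: rq_sq)
  also have "\<omega>\<^sup>2 * ((1 - \<sigma>\<^sup>2) * ((r x)\<^sup>2 * (q x)\<^sup>2)) / ((r x)\<^sup>2 * (q x)\<^sup>2) = \<omega>\<^sup>2 * (1 - \<sigma>\<^sup>2)"
    by simp
  finally show ?thesis using \<omega>(2) by simp
qed

lemma \<nu>_normal: "\<nu> p \<in> normal_space F p"
proof -
  define x where "x = p$1"
  have "F1 p \<bullet> \<nu> p = - 2 * pi * S x / r x * \<alpha> x * ((sin (2 * pi * p$2))\<^sup>2 + (cos (2 * pi * p$2))\<^sup>2)
      + (2 * pi * S x / q x * \<beta> x - q x * \<phi>' x * \<gamma> x) * ((sin (\<phi> x))\<^sup>2 + (cos (\<phi> x))\<^sup>2)"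
    unfolding distrib_left by (simp add: F1_def Let_def \<nu>_def x_def inner_real4 power2_eq_square algebra_simps)
  also have "\<dots> = 2 * pi * \<omega> * w x * S x * ((r x)\<^sup>2 + (q x)\<^sup>2 - 1) / ((r x)\<^sup>2 * (q x)\<^sup>2)"
    by (simp add: \<alpha>_def \<beta>_def \<gamma>_def \<phi>'_def field_simps power2_eq_square)
  also have "\<dots> = 0" by (simp add: rq_sq)
  finally have 1: "F1 p \<bullet> \<nu> p = 0" .
  have "F2 p \<bullet> \<nu> p = 0" by (simp add: F2_def \<nu>_def inner_real4 Let_def)
  with 1 show ?thesis by (simp add: normal_space_iff dir_deriv_F inner_add_left)
qed

lemma metric_F: "metric_coeff F 1 2 p = 0"
  by (simp add: metric_coeff_def dir_deriv_F F1_F2)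

lemma frame_F: "parallel_normal_frame F F \<nu>"
  using spherical_parallel_normal_frame[OF immersion_F F_F zero_less_one smooth_\<nu> \<nu>_normal \<nu>_\<nu> F_\<nu>]
  by simp

text \<open>In the frame of position vector and normal the two coefficients are the universal
  \<open>- 2\<close> of a spherical surface and the curvature sum, in which the terms with
  \<open>c / u\<close> cancel.\<close>

lemma mean_curvature_F: "mean_curvature F p = - 2 *\<^sub>R F p + (2 * \<omega> * \<sigma>) *\<^sub>R \<nu> p"
proof -
  note L = torus_immersionD[OF immersion_F]
  have "mean_curvature F p \<bullet> \<nu> p = \<kappa> 1 (p$1) + \<kappa> 2 (p$1)"
    by (rule mean_curvature_inner_shape[OF immersion_F smooth_\<nu> \<nu>_normal metric_F dir_deriv_\<nu>])
  also have "\<dots> = 2 * \<omega> * \<sigma>" by (simp add: \<kappa>_def algebra_simps)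
  finally show ?thesis
    using orthonormal_normal_expand[OF L(2,3) spherical_normal(1)[OF L(1) F_F] \<nu>_normal F_F \<nu>_\<nu> F_\<nu>
        mean_curvature_normal[OF L(2,3)], of p] spherical_mean_curvature[OF immersion_F F_F, of p]
    by simp
qed

lemma mean_curvature_F_inner: "mean_curvature F p \<bullet> mean_curvature F p = 4 + (2 * \<omega> * \<sigma>)\<^sup>2"
  unfolding mean_curvature_F using F_\<nu>[of p]
  by (simp add: inner_diff_left inner_diff_right inner_commute F_F \<nu>_\<nu> power2_eq_square)

lemma dir_deriv_mean_curvature_F:
  "dir_deriv (mean_curvature F) p (axis i 1) =
    - (2 + 2 * \<omega> * \<sigma> * \<kappa> i (p$1)) *\<^sub>R dir_deriv F p (axis i 1)"
proof -
  have "mean_curvature F = (\<lambda>p. - 2 *\<^sub>R F p + (2 * \<omega> * \<sigma>) *\<^sub>R \<nu> p)"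
    using mean_curvature_F by blast
  then have "dir_deriv (mean_curvature F) p v = - 2 *\<^sub>R dir_deriv F p v + (2 * \<omega> * \<sigma>) *\<^sub>R dir_deriv \<nu> p v" for v
    by (simp only:) (intro dir_deriv_eq has_derivative_add has_derivative_scaleR_right
        smooth_on_has_derivative smooth_F smooth_\<nu>)
  then show ?thesis by (simp add: dir_deriv_\<nu> scaleR_diff_left scaleR_add_left mult.assoc)
qed

text \<open>The sum of squares depends on the point only through \<open>(c / u)^2\<close>. The two
  chosen points realise the extreme values \<open>a + b\<close> and \<open>a - b\<close> of
  \<open>u\<close>, which differ because \<open>b > 0\<close>.\<close>

lemma shape_eigenvalues_nonconstant:
  defines "l \<equiv> \<lambda>i p. 2 + 2 * \<omega> * \<sigma> * \<kappa> i (p$1)"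
  shows "(l 1 (0 :: real ^ 2))\<^sup>2 + (l 2 0)\<^sup>2 \<noteq> (l 1 (vec (1/4) :: real ^ 2))\<^sup>2 + (l 2 (vec (1/4)))\<^sup>2"
proof -
  have l: "(l 1 p)\<^sup>2 + (l 2 p)\<^sup>2 = 2 * (2 + 2 * \<omega>\<^sup>2 * \<sigma>\<^sup>2)\<^sup>2 + 8 * \<omega> ^ 4 * \<sigma>\<^sup>2 * (c / u (p$1))\<^sup>2" for p :: "real ^ 2"
    by (simp add: l_def \<kappa>_def) algebra
  have "u 0 = a + b" "u (1/4) = a - b" by (simp_all add: u_def profile_def)
  moreover from this have "(c / u 0)\<^sup>2 \<noteq> (c / u (1/4))\<^sup>2"
    using cd b u_bounds[of 0] by (simp add: power2_eq_iff field_simps)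
  ultimately show ?thesis
    unfolding l using \<omega>(1) \<sigma>_bounds(1) by simp
qed

end

theorem theorem1p3:
  shows "\<exists>F0 :: real ^ 2 \<Rightarrow> real ^ 4.
    torus_embedding F0 \<and>
    nowhere_vanishing_mean_curvature F0 \<and>
    parallel_principal_normal F0 \<and>
    flat_normal_bundle F0 \<and>
    (\<forall>T F. mean_curvature_flow F0 T F \<longrightarrow>
       (\<exists>\<delta>. 0 < \<delta> \<and> ereal \<delta> < T \<and>
          (\<forall>t\<in>{0<..<\<delta>}. nowhere_vanishing_mean_curvature (F t) \<and>
                         \<not> parallel_principal_normal (F t))) \<and>
       (\<forall>t. 0 \<le> t \<and> ereal t < T \<longrightarrow> flat_normal_bundle (F t)))"
proof -
  obtain a b c d :: real where abcd: "0 < b" "b < a" "a < 1 / 2" "a + b < 1" "0 < c" "c < d"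
    "c\<^sup>2 = a\<^sup>2 - b\<^sup>2" "d\<^sup>2 = (1 - a)\<^sup>2 - b\<^sup>2" "integral {0..1} (angular_speed c d a b) = 1"
    by (rule period_problem)
  have u: "0 < profile a b x" "profile a b x < 1" for x
    using profile_bounds[of b a x] abcd(1-4) by auto
  have "continuous_on UNIV (\<lambda>x. 2 * pi * angular_speed c d a b x)"
    by (intro continuous_intros continuous_on_angular_speed u)
  then obtain \<phi> where \<phi>: "\<And>x. (\<phi> has_real_derivative 2 * pi * angular_speed c d a b x) (at x)"
    using antiderivative_real by blast
  \<comment> \<open>One unit of \<open>x\<close> contains two periods of the profile, hence the
    winding number 2 supplied below.\<close>
  have "profile a b (x + 1) = profile a b x" for x
    using sin_cos_eq_iff[of "4 * pi * (x + 1)" "4 * pi * x"]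
    by (auto simp: profile_def algebra_simps intro!: exI[of _ 2])
  then have "\<phi> (x + 1) = \<phi> x + integral {0..1} (\<lambda>x. 2 * pi * angular_speed c d a b x)" for x
    by (intro antiderivative_periodic \<phi>) (simp add: angular_speed_def)
  then have "\<phi> (x + 1) = \<phi> x + 2 * pi" for x using abcd(9) by simp
  then interpret unduloid a b c d \<phi> using abcd \<phi> by unfold_locales
  have "mean_curvature F p \<noteq> 0" for p
    using spherical_mean_curvature[OF immersion_F F_F, of p] by auto
  then have "nowhere_vanishing_mean_curvature F" by (simp add: nowhere_vanishing_mean_curvature_def)
  moreover have "parallel_principal_normal F"
    by (rule parallel_principal_normal_if_constant_coeffs[OF torus_immersionD(2)[OF immersion_F] frame_F mean_curvature_F])
  moreover have "flat_normal_bundle F"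
    by (rule flat_normal_bundle_if_parallel_frame[OF immersion_F frame_F])
  ultimately show ?thesis
    using embedding_F mean_curvature_flow_spherical[OF _ F_F metric_F dir_deriv_mean_curvature_F
        mean_curvature_F_inner shape_eigenvalues_nonconstant]
    by blast
qed

end
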